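(* Write $c=(f_0,a,Q)\in V_2=\mathcal H_0\oplus\mathcal H_1\oplus\mathcal H_2$ with $f_0\in\mathbb R$, $a\in\mathbb R^3$, and $Q$ a traceless symmetric $3\times3$ real matrix. The seven invariants $$f_0,\quad |a|^2,\quad \operatorname{tr}Q^2,\quad \det Q,\quad a^{\top}Qa,\quad a^{\top}Q^2a,\quad \varepsilon:=\det(a,Qa,Q^2a),$$ of degrees $1,2,2,3,3,4,6$, separate the $\mathrm{SO}(3)$-orbits in $V_2$. The first six are $\mathrm O(3)$-invariants and $\varepsilon$ is a pseudo-invariant. They satisfy the relation $\varepsilon^2=\det\operatorname{Gram}(a,Qa,Q^2a)$, whose right side is a polynomial in the other six by $Q^3=\tfrac12(\operatorname{tr}Q^2)Q+(\det Q)\,1$. In binary-form language, with $F=F_{f_2}$: $|a|^2=\tfrac14\operatorname{disc}Q_a$; $\operatorname{tr}Q^2$ and $\det Q$ are, up to nonzero constants, the quartic invariants $I(F)$ and $J(F)$; $a^{\top}Qa$ is proportional to $(Q_a^2,F)_4$; and $a^{\top}Q^2a$ and $\varepsilon$ are joint invariants of bidegrees $(2,2)$ and $(3,3)$ in $(Q_a,F)$.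
   Context: $\mathcal H_l$ is the space of real homogeneous harmonic polynomials of degree $l$ on $\mathbb R^3$; $\mathrm O(3)$ acts by $(R\cdot f)(x)=f(R^{-1}x)$. Elements of $\mathcal H_1$ are $f_1=\langle a,x\rangle$, $a\in\mathbb R^3$, and elements of $\mathcal H_2$ are $f_2=x^{\top}Qx$ with $Q$ traceless symmetric, so $R\in\mathrm{SO}(3)$ acts by $(f_0,a,Q)\mapsto(f_0,Ra,RQR^{\top})$ and $-1$ acts by $(f_0,a,Q)\mapsto(f_0,-a,Q)$. An $\mathrm O(3)$-invariant is an $\mathrm{SO}(3)$-invariant polynomial unchanged by reflections; a pseudo-invariant is one that changes sign under every reflection. A set of invariants separates orbits if two points with equal values of all the invariants lie in one orbit. $\operatorname{Gram}$ is the matrix of inner products. Binary forms: $v(z_0,z_1)=(z_0^2-z_1^2,i(z_0^2+z_1^2),2z_0z_1)$, $F_f=f\circ v$, so $F_{f_2}$ is a binary quartic, and $Q_a(z)=\langle a,v(z)\rangle=(a_1+ia_2)z_0^2+2a_3z_0z_1+(-a_1+ia_2)z_1^2$. $\operatorname{disc}(\alpha z_0^2+2\beta z_0z_1+\gamma z_1^2)=4(\beta^2-\alpha\gamma)$. For a quartic $F=\sum_k\binom4k a_k z_0^{4-k}z_1^k$: $I=a_0a_4-4a_1a_3+3a_2^2$ and $J=\det\begin{pmatrix} a_0 & a_1 & a_2 \\ {} a_1 & a_2 & a_3 \\ {} a_2 & a_3 & a_4 \end{pmatrix}$. The $k$-th transvectant of $F\in\mathrm{Sym}^m$, $G\in\mathrm{Sym}^n$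 (binary forms of degrees $m,n$) is $(F,G)_k=\frac{(m-k)!(n-k)!}{m!\,n!}\sum_{i=0}^k(-1)^i\binom ki\frac{\partial^kF}{\partial z_0^{k-i}\partial z_1^i}\frac{\partial^kG}{\partial z_0^i\partial z_1^{k-i}}$. Joint invariants are polynomials invariant under the simultaneous action $F(z)\mapsto F(g^{-1}z)$ of $\mathrm{SL}_2(\mathbb C)$ on all forms; the bidegree is (degree in $Q_a$, degree in $F$). *)

theory Defs
  imports "HOL-Analysis.Analysis"
begin

section \<open>Harmonic polynomials and the coordinates on \<open>V\<^sub>2\<close>\<close>

definition homogeneous_polynomial :: "nat \<Rightarrow> (real^3 \<Rightarrow> real) \<Rightarrow> bool" where
  "homogeneous_polynomial l f \<longleftrightarrow>
     (\<exists>C. \<forall>x. f x = (\<Sum>(i,j,k)\<in>{(i,j,k). i + j + k = l}. C i j k * x$1^i * x$2^j * x$3^k))"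

definition laplacian :: "(real^3 \<Rightarrow> real) \<Rightarrow> real^3 \<Rightarrow> real" where
  "laplacian f x = (\<Sum>i\<in>UNIV. (deriv ^^ 2) (\<lambda>t. f (x + t *\<^sub>R axis i 1)) 0)"

definition harmonic_space :: "nat \<Rightarrow> (real^3 \<Rightarrow> real) set" where
  "harmonic_space l = {f. homogeneous_polynomial l f \<and> (\<forall>x. laplacian f x = 0)}"

type_synonym harmonics = "(real^3 \<Rightarrow> real) \<times> (real^3 \<Rightarrow> real) \<times> (real^3 \<Rightarrow> real)"
type_synonym coords = "real \<times> (real^3) \<times> (real^3^3)"

definition harmonic_sum :: "harmonics set" where
  "harmonic_sum = harmonic_space 0 \<times> harmonic_space 1 \<times> harmonic_space 2"

definition rotate_harmonics :: "real^3^3 \<Rightarrow> harmonics \<Rightarrow> harmonics" where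
  "rotate_harmonics R = (\<lambda>(h0,h1,h2).
     (\<lambda>x. h0 (matrix_inv R *v x), \<lambda>x. h1 (matrix_inv R *v x), \<lambda>x. h2 (matrix_inv R *v x)))"

text \<open>The forms \<open>\<langle>a,x\<rangle>\<close> and \<open>x\<^sup>T Q x\<close>. They are polymorphic because the binary forms
  below evaluate the same polynomials at complex vectors; the pairing is bilinear, never
  Hermitian.\<close>

definition linear_form :: "('a::comm_ring_1)^3 \<Rightarrow> 'a^3 \<Rightarrow> 'a" where
  "linear_form a x = (\<Sum>i\<in>UNIV. a$i * x$i)"

definition quadratic_form :: "('a::comm_ring_1)^3^3 \<Rightarrow> 'a^3 \<Rightarrow> 'a" where
  "quadratic_form Q x = (\<Sum>i\<in>UNIV. \<Sum>j\<in>UNIV. x$i * Q$i$j * x$j)"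

definition traceless_symmetric :: "(real^3^3) set" where
  "traceless_symmetric = {Q. transpose Q = Q \<and> trace Q = 0}"

definition V2 :: "coords set" where
  "V2 = UNIV \<times> UNIV \<times> traceless_symmetric"

definition to_harmonics :: "coords \<Rightarrow> harmonics" where
  "to_harmonics = (\<lambda>(f0,a,Q). (\<lambda>x. f0, linear_form a, quadratic_form Q))"

text \<open>One formula for all of \<open>O(3)\<close>: on \<open>SO(3)\<close> it is \<open>(f\<^sub>0, Ra, RQR\<^sup>T)\<close>, and
  \<open>-1\<close> gives \<open>(f\<^sub>0, -a, Q)\<close>.\<close>

definition act :: "real^3^3 \<Rightarrow> coords \<Rightarrow> coords" where
  "act R = (\<lambda>(f0,a,Q). (f0, R *v a, R ** Q ** transpose R))"


section \<open>Invariants\<close>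

definition polynomial_on_V2 :: "(coords \<Rightarrow> real) \<Rightarrow> bool" where
  "polynomial_on_V2 \<phi> \<longleftrightarrow> (\<exists>p. real_polynomial_function p \<and> (\<forall>c\<in>V2. \<phi> c = p c))"

definition polynomial_of_degree :: "nat \<Rightarrow> (coords \<Rightarrow> real) \<Rightarrow> bool" where
  "polynomial_of_degree d \<phi> \<longleftrightarrow> polynomial_on_V2 \<phi> \<and>
     (\<forall>t. \<forall>c\<in>V2. \<phi> (t *\<^sub>R c) = t ^ d * \<phi> c) \<and> (\<exists>c\<in>V2. \<phi> c \<noteq> 0)"

definition SO3_invariant :: "(coords \<Rightarrow> real) \<Rightarrow> bool" where
  "SO3_invariant \<phi> \<longleftrightarrow> polynomial_on_V2 \<phi> \<and>
     (\<forall>R. rotation_matrix R \<longrightarrow> (\<forall>c\<in>V2. \<phi> (act R c) = \<phi> c))"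

text \<open>Reflections are taken to be all improper elements of \<open>O(3)\<close> (determinant \<open>-1\<close>), so that
  both \<open>-1\<close> and the mirror reflections are included. For \<open>SO(3)\<close>-invariant polynomials
  any one of them decides the matter.\<close>

definition O3_invariant :: "(coords \<Rightarrow> real) \<Rightarrow> bool" where
  "O3_invariant \<phi> \<longleftrightarrow> SO3_invariant \<phi> \<and>
     (\<forall>R. rotoinversion_matrix R \<longrightarrow> (\<forall>c\<in>V2. \<phi> (act R c) = \<phi> c))"

definition pseudo_invariant :: "(coords \<Rightarrow> real) \<Rightarrow> bool" where
  "pseudo_invariant \<phi> \<longleftrightarrow> SO3_invariant \<phi> \<and>
     (\<forall>R. rotoinversion_matrix R \<longrightarrow> (\<forall>c\<in>V2. \<phi> (act R c) = - \<phi> c))"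

definition separates_SO3_orbits :: "(coords \<Rightarrow> real) set \<Rightarrow> bool" where
  "separates_SO3_orbits S \<longleftrightarrow>
     (\<forall>c\<in>V2. \<forall>d\<in>V2. (\<forall>\<phi>\<in>S. \<phi> c = \<phi> d) \<longrightarrow> (\<exists>R. rotation_matrix R \<and> act R c = d))"

definition inv_f0 :: "coords \<Rightarrow> real" where
  "inv_f0 = (\<lambda>(f0,a,Q). f0)"

definition inv_aa :: "coords \<Rightarrow> real" where
  "inv_aa = (\<lambda>(f0,a,Q). (norm a)\<^sup>2)"

definition inv_trQ2 :: "coords \<Rightarrow> real" where
  "inv_trQ2 = (\<lambda>(f0,a,Q). trace (Q ** Q))"

definition inv_detQ :: "coords \<Rightarrow> real" where
  "inv_detQ = (\<lambda>(f0,a,Q). det Q)"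

definition inv_aQa :: "coords \<Rightarrow> real" where
  "inv_aQa = (\<lambda>(f0,a,Q). a \<bullet> (Q *v a))"

definition inv_aQ2a :: "coords \<Rightarrow> real" where
  "inv_aQ2a = (\<lambda>(f0,a,Q). a \<bullet> ((Q ** Q) *v a))"

text \<open>\<open>det(u,v,w)\<close> is the determinant with columns \<open>u, v, w\<close>; \<open>vector\<close> lists rows.\<close>

definition inv_eps :: "coords \<Rightarrow> real" where
  "inv_eps = (\<lambda>(f0,a,Q). det (transpose (vector [a, Q *v a, (Q ** Q) *v a] :: real^3^3)))"

definition Gram :: "('a::real_inner)^3 \<Rightarrow> real^3^3" where
  "Gram w = (\<chi> i j. w$i \<bullet> w$j)"


section \<open>Binary forms\<close>

text \<open>A binary form is a function on \<open>\<complex>\<^sup>2\<close>, with \<open>z\<^sub>0 = z$1\<close> and \<open>z\<^sub>1 = z$2\<close>.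
  Coefficients carry the binomial normalisation, so \<open>\<alpha>z\<^sub>0\<^sup>2 + 2\<beta>z\<^sub>0z\<^sub>1 + \<gamma>z\<^sub>1\<^sup>2\<close> has
  coefficients \<open>\<alpha>, \<beta>, \<gamma>\<close>.\<close>

type_synonym cfun2 = "complex^2 \<Rightarrow> complex"

definition bform :: "nat \<Rightarrow> (nat \<Rightarrow> complex) \<Rightarrow> cfun2" where
  "bform n a = (\<lambda>z. \<Sum>k\<le>n. of_nat (n choose k) * a k * z$1 ^ (n - k) * z$2 ^ k)"

definition binary_forms :: "nat \<Rightarrow> cfun2 set" where
  "binary_forms n = range (bform n)"

definition bcoeff :: "nat \<Rightarrow> cfun2 \<Rightarrow> nat \<Rightarrow> complex" where
  "bcoeff n F k = (THE c. \<exists>a. F = bform n a \<and> a k = c)"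

definition disc :: "cfun2 \<Rightarrow> complex" where
  "disc q = 4 * ((bcoeff 2 q 1)\<^sup>2 - bcoeff 2 q 0 * bcoeff 2 q 2)"

definition quartic_I :: "cfun2 \<Rightarrow> complex" where
  "quartic_I F = (let a = bcoeff 4 F in a 0 * a 4 - 4 * a 1 * a 3 + 3 * (a 2)\<^sup>2)"

definition quartic_J :: "cfun2 \<Rightarrow> complex" where
  "quartic_J F = (let a = bcoeff 4 F in
     det (vector [vector [a 0, a 1, a 2], vector [a 1, a 2, a 3], vector [a 2, a 3, a 4]]
       :: complex^3^3))"

definition partial :: "2 \<Rightarrow> cfun2 \<Rightarrow> cfun2" where
  "partial i F = (\<lambda>z. deriv (\<lambda>t. F (z + t *s axis i 1)) 0)"

text \<open>\<open>transvectant m n k F G\<close> is \<open>(F,G)\<^sub>k\<close> for \<open>F\<close> of degree \<open>m\<close> and \<open>G\<close> of degree \<open>n\<close>.\<close>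

definition transvectant :: "nat \<Rightarrow> nat \<Rightarrow> nat \<Rightarrow> cfun2 \<Rightarrow> cfun2 \<Rightarrow> cfun2" where
  "transvectant m n k F G = (\<lambda>z.
     (fact (m - k) * fact (n - k)) / (fact m * fact n) *
     (\<Sum>i\<le>k. (-1) ^ i * of_nat (k choose i) *
        (partial 1 ^^ (k - i)) ((partial 2 ^^ i) F) z *
        (partial 1 ^^ i) ((partial 2 ^^ (k - i)) G) z))"

definition SL2_act :: "complex^2^2 \<Rightarrow> cfun2 \<Rightarrow> cfun2" where
  "SL2_act g F = (\<lambda>z. F (matrix_inv g *v z))"

text \<open>Polynomials in the coefficients of a binary quadratic and a binary quartic.\<close>

inductive joint_polynomial :: "((nat \<Rightarrow> complex) \<Rightarrow> (nat \<Rightarrow> complex) \<Rightarrow> complex) \<Rightarrow> bool" where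
  const: "joint_polynomial (\<lambda>a b. c)"
| quadratic_coeff: "k \<le> 2 \<Longrightarrow> joint_polynomial (\<lambda>a b. a k)"
| quartic_coeff: "k \<le> 4 \<Longrightarrow> joint_polynomial (\<lambda>a b. b k)"
| add: "joint_polynomial p \<Longrightarrow> joint_polynomial q \<Longrightarrow> joint_polynomial (\<lambda>a b. p a b + q a b)"
| mult: "joint_polynomial p \<Longrightarrow> joint_polynomial q \<Longrightarrow> joint_polynomial (\<lambda>a b. p a b * q a b)"

definition joint_invariant :: "nat \<Rightarrow> nat \<Rightarrow> (cfun2 \<Rightarrow> cfun2 \<Rightarrow> complex) \<Rightarrow> bool" where
  "joint_invariant p q \<Phi> \<longleftrightarrow>
     (\<exists>P. joint_polynomial P \<and> (\<forall>a b. \<Phi> (bform 2 a) (bform 4 b) = P a b)) \<and>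
     (\<forall>g. det g = 1 \<longrightarrow> (\<forall>A\<in>binary_forms 2. \<forall>F\<in>binary_forms 4.
        \<Phi> (SL2_act g A) (SL2_act g F) = \<Phi> A F)) \<and>
     (\<forall>s t. \<forall>A\<in>binary_forms 2. \<forall>F\<in>binary_forms 4.
        \<Phi> (\<lambda>z. s * A z) (\<lambda>z. t * F z) = s ^ p * t ^ q * \<Phi> A F) \<and>
     (\<exists>A\<in>binary_forms 2. \<exists>F\<in>binary_forms 4. \<Phi> A F \<noteq> 0)"

definition null_vector :: "complex^2 \<Rightarrow> complex^3" where
  "null_vector z = vector [(z$1)\<^sup>2 - (z$2)\<^sup>2, \<i> * ((z$1)\<^sup>2 + (z$2)\<^sup>2), 2 * z$1 * z$2]"

text \<open>\<open>Q\<^sub>a(z) = \<langle>a, v(z)\<rangle>\<close> and \<open>F\<^sub>f = f \<circ> v\<close> for \<open>f(x) = x\<^sup>T Q x\<close>, the real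
  polynomial \<open>f\<close> being evaluated at the complex vector \<open>v(z)\<close>.\<close>

definition binary_quadratic :: "real^3 \<Rightarrow> cfun2" where
  "binary_quadratic a = linear_form (\<chi> i. complex_of_real (a$i)) \<circ> null_vector"

definition binary_quartic :: "real^3^3 \<Rightarrow> cfun2" where
  "binary_quartic Q = quadratic_form (\<chi> i j. complex_of_real (Q$i$j)) \<circ> null_vector"

lemma bform_inject:
  assumes "bform n a = bform n b" "k \<le> n"
  shows "a k = b k"
proof -
  have "(\<Sum>k\<le>n. (of_nat (n choose k) * a k) * t ^ k) = (\<Sum>k\<le>n. (of_nat (n choose k) * b k) * t ^ k)"
    for t
    using fun_cong[OF assms(1), of "vector [1, t]"] by (simp add: bform_def)
  then have "\<forall>k\<le>n. of_nat (n choose k) * a k = of_nat (n choose k) * b k"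
    by (subst polyfun_eq_coeffs[symmetric]) auto
  with assms(2) show ?thesis by auto
qed

lemma bcoeff_bform: "k \<le> n \<Longrightarrow> bcoeff n (bform n a) k = a k"
  unfolding bcoeff_def by (rule the_equality) (auto dest: bform_inject)

lemma binary_quadratic_eq:
  "binary_quadratic a z =
     (complex_of_real (a$1) + \<i> * a$2) * (z$1)\<^sup>2 + 2 * a$3 * z$1 * z$2
     + (- complex_of_real (a$1) + \<i> * a$2) * (z$2)\<^sup>2"
  by (simp add: binary_quadratic_def linear_form_def null_vector_def sum_3 algebra_simps)

lemma binary_quadratic_in_forms: "binary_quadratic a \<in> binary_forms 2"
proof -
  have "binary_quadratic a = bform 2 (\<lambda>k. if k = 0 then complex_of_real (a$1) + \<i> * a$2
      else if k = 1 then a$3 else - complex_of_real (a$1) + \<i> * a$2)"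
    by (rule ext) (simp add: binary_quadratic_eq bform_def eval_nat_numeral algebra_simps)
  then show ?thesis by (simp add: binary_forms_def)
qed

lemma binary_quartic_in_forms: "binary_quartic Q \<in> binary_forms 4"
proof -
  have "binary_quartic Q = bform 4 (\<lambda>k.
     if k = 0 then complex_of_real (Q$1$1) - Q$2$2 + \<i> * (Q$1$2 + Q$2$1)
     else if k = 1 then (complex_of_real (Q$1$3 + Q$3$1) + \<i> * (Q$2$3 + Q$3$2)) / 2
     else if k = 2 then (- 2 * complex_of_real (Q$1$1) - 2 * Q$2$2 + 4 * Q$3$3) / 6
     else if k = 3 then (- complex_of_real (Q$1$3 + Q$3$1) + \<i> * (Q$2$3 + Q$3$2)) / 2
     else complex_of_real (Q$1$1) - Q$2$2 - \<i> * (Q$1$2 + Q$2$1))" (is "_ = ?F")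
  proof
    fix z :: "complex^2"
    define x y where "x = z$1" and "y = z$2"
    have c: "4 choose 2 = (6::nat)" "4 choose 3 = (4::nat)"
      by (simp_all add: eval_nat_numeral)
    have "?F z = (Q$1$1 - Q$2$2 + \<i> * (Q$1$2 + Q$2$1)) * x^4
       + 2 * (Q$1$3 + Q$3$1 + \<i> * (Q$2$3 + Q$3$2)) * x^3 * y
       + (- 2 * Q$1$1 - 2 * Q$2$2 + 4 * Q$3$3) * x^2 * y^2
       + 2 * (- Q$1$3 - Q$3$1 + \<i> * (Q$2$3 + Q$3$2)) * x * y^3
       + (Q$1$1 - Q$2$2 - \<i> * (Q$1$2 + Q$2$1)) * y^4"
      using c by (simp add: bform_def x_def y_def atMost_nat_numeral atMost_Suc algebra_simps
          add_divide_distrib diff_divide_distrib)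
    also have "\<dots> = binary_quartic Q z"
      unfolding binary_quartic_def quadratic_form_def null_vector_def sum_3 comp_def
        x_def[symmetric] y_def[symmetric]
      by (simp add: algebra_simps power2_eq_square power3_eq_cube power4_eq_xxxx)
    finally show "binary_quartic Q z = ?F z" ..
  qed
  then show ?thesis by (simp add: binary_forms_def)
qed


section \<open>The coordinates identify \<open>V2\<close> with \<open>H\<^sub>0 \<oplus> H\<^sub>1 \<oplus> H\<^sub>2\<close> equivariantly\<close>

lemma matrix_inv_orthogonal:
  fixes R :: "real^'n^'n"
  assumes "orthogonal_matrix R"
  shows "matrix_inv R = transpose R"
proof -
  have "R ** transpose R = mat 1" "transpose R ** R = mat 1"
    using assms by (auto simp: orthogonal_matrix_def)
  then have "\<exists>B. R ** B = mat 1 \<and> B ** R = mat 1" by blast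
  from someI_ex[OF this] have 1: "matrix_inv R ** R = mat 1"
    by (simp add: matrix_inv_def)
  have "matrix_inv R = matrix_inv R ** (R ** transpose R)"
    using assms by (simp add: orthogonal_matrix_def)
  also have "\<dots> = transpose R"
    by (simp add: matrix_mul_assoc 1)
  finally show ?thesis .
qed

lemma linear_form_inner: "linear_form a x = a \<bullet> (x :: real^3)"
  by (simp add: linear_form_def inner_vec_def)

lemma quadratic_form_inner: "quadratic_form Q x = x \<bullet> (Q *v (x :: real^3))"
  by (simp add: quadratic_form_def inner_vec_def matrix_vector_mult_def sum_distrib_left mult.assoc)

lemma to_harmonics_act:
  assumes "orthogonal_matrix R"
  shows "to_harmonics (act R c) = rotate_harmonics R (to_harmonics c)"
proof -
  have i: "matrix_inv R = transpose R"
    using assms by (rule matrix_inv_orthogonal)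
  have 1: "(R *v a) \<bullet> x = a \<bullet> (transpose R *v x)" for a x
    by (metis dot_lmul_matrix transpose_matrix_vector transpose_transpose inner_commute)
  have 2: "x \<bullet> (R *v a) = (transpose R *v x) \<bullet> a" for a x
    by (metis 1 inner_commute)
  show ?thesis
    by (cases c) (auto simp: to_harmonics_def act_def rotate_harmonics_def linear_form_inner
        quadratic_form_inner i 1 2 matrix_vector_mul_assoc[symmetric])
qed

lemma act_V2:
  assumes "orthogonal_matrix R" "c \<in> V2"
  shows "act R c \<in> V2"
proof -
  have "trace (R ** Q ** transpose R) = trace Q" for Q :: "real^3^3"
    using assms(1) trace_mul_sym[of "R ** Q" "transpose R"]
    by (simp add: matrix_mul_assoc orthogonal_matrix_def)
  with assms(2) show ?thesis
    by (auto simp: V2_def act_def traceless_symmetric_def matrix_transpose_mul matrix_mul_assoc)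
qed

lemma inj_on_to_harmonics: "inj_on to_harmonics V2"
proof -
  have "a = b" if "linear_form a = linear_form b" for a b :: "real^3"
    using fun_cong[OF that] by (metis linear_form_inner inner_commute vector_eq_rdot)
  moreover have "P = Q" if "quadratic_form P = quadratic_form Q"
    "P \<in> traceless_symmetric" "Q \<in> traceless_symmetric" for P Q :: "real^3^3"
  proof -
    have s: "P$i$j = P$j$i" "Q$i$j = Q$j$i" for i j
      using that(2,3) by (auto simp: traceless_symmetric_def transpose_def vec_eq_iff)
    have e: "quadratic_form P (vector [x,y,z]) = quadratic_form Q (vector [x,y,z])" for x y z
      using that(1) by simp
    from e[of 1 0 0] e[of 0 1 0] e[of 0 0 1] e[of 1 1 0] e[of 1 0 1] e[of 0 1 1]
    show ?thesis
      using s[of 1 2] s[of 1 3] s[of 2 3] by (simp add: quadratic_form_def sum_3 vec_eq_iff forall_3)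
  qed
  ultimately show ?thesis
    by (auto simp: inj_on_def to_harmonics_def V2_def fun_eq_iff)
qed

lemma triples_sum: "{(i,j,k). i + j + k = (0::nat)} = {(0,0,0)}"
  "{(i,j,k). i + j + k = (1::nat)} = {(1,0,0), (0,1,0), (0,0,1)}"
  "{(i,j,k). i + j + k = (2::nat)} =
     {(2,0,0), (0,2,0), (0,0,2), (1,1,0), (1,0,1), (0,1,1)}"
proof -
  have "(i,j,k) \<in> {(2,0,0), (0,2,0), (0,0,2), (1,1,0), (1,0,1), (0,1,1)}"
    if "i + j + k = 2" for i j k :: nat
  proof -
    from that have k: "k = 2 - i - j" and "i < 3" "j < 3 - i" by simp_all
    then have "i = 0 \<and> j = 0 \<or> i = 0 \<and> j = 1 \<or> i = 0 \<and> j = 2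
        \<or> i = 1 \<and> j = 0 \<or> i = 1 \<and> j = 1 \<or> i = 2 \<and> j = 0"
      by (auto simp: eval_nat_numeral less_Suc_eq)
    then show ?thesis
      unfolding k by (elim disjE conjE) simp_all
  qed
  then have "{(i,j,k). i + j + k = (2::nat)} \<subseteq>
     {(2,0,0), (0,2,0), (0,0,2), (1,1,0), (1,0,1), (0,1,1)}"
    by (intro subsetI) (simp only: mem_Collect_eq split_paired_all case_prod_conv)
  moreover have "{(2,0,0), (0,2,0), (0,0,2), (1,1,0), (1,0,1), (0,1,1)} \<subseteq>
     {(i,j,k). i + j + k = (2::nat)}" by simp
  ultimately show "{(i,j,k). i + j + k = (2::nat)} =
     {(2,0,0), (0,2,0), (0,0,2), (1,1,0), (1,0,1), (0,1,1)}" by (rule subset_antisym)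
qed auto

lemma homogeneous_polynomial_0: "homogeneous_polynomial 0 f \<longleftrightarrow> (\<exists>c. f = (\<lambda>x. c))"
  by (auto simp: homogeneous_polynomial_def triples_sum)

lemma homogeneous_polynomial_1: "homogeneous_polynomial 1 f \<longleftrightarrow> (\<exists>a. f = linear_form a)"
proof
  assume "homogeneous_polynomial 1 f"
  then obtain C where C: "\<forall>x. f x =
      (\<Sum>(i,j,k)\<in>{(i,j,k). i + j + k = 1}. C i j k * x$1^i * x$2^j * x$3^k)"
    unfolding homogeneous_polynomial_def by blast
  have "f x = C 1 0 0 * x$1 + C 0 1 0 * x$2 + C 0 0 1 * x$3" for x
    using C unfolding triples_sum by simp
  then have "f = linear_form (vector [C 1 0 0, C 0 1 0, C 0 0 1])"
    by (auto simp: linear_form_def sum_3)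
  then show "\<exists>a. f = linear_form a" ..
next
  assume "\<exists>a. f = linear_form a"
  then obtain a where "f = linear_form a" ..
  then show "homogeneous_polynomial 1 f"
    unfolding homogeneous_polynomial_def triples_sum
    by (intro exI[of _ "\<lambda>i j k. if i = 1 then a$1 else if j = 1 then a$2 else a$3"])
       (auto simp: linear_form_def sum_3)
qed

lemma homogeneous_polynomial_2:
  "homogeneous_polynomial 2 f \<longleftrightarrow> (\<exists>Q. transpose Q = Q \<and> f = quadratic_form Q)"
proof
  assume "homogeneous_polynomial 2 f"
  then obtain C where C': "\<forall>x. f x =
      (\<Sum>(i,j,k)\<in>{(i,j,k). i + j + k = 2}. C i j k * x$1^i * x$2^j * x$3^k)"
    unfolding homogeneous_polynomial_def by blast
  have C: "f x = C 2 0 0 * (x$1)^2 + C 0 2 0 * (x$2)^2 + C 0 0 2 * (x$3)^2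
      + C 1 1 0 * x$1 * x$2 + C 1 0 1 * x$1 * x$3 + C 0 1 1 * x$2 * x$3" for x
    using C' unfolding triples_sum by simp
  let ?Q = "vector [vector [C 2 0 0, C 1 1 0 / 2, C 1 0 1 / 2],
      vector [C 1 1 0 / 2, C 0 2 0, C 0 1 1 / 2],
      vector [C 1 0 1 / 2, C 0 1 1 / 2, C 0 0 2]] :: real^3^3"
  have "f = quadratic_form ?Q"
    by (rule ext) (simp add: C quadratic_form_def sum_3 algebra_simps power2_eq_square)
  moreover have "transpose ?Q = ?Q"
    by (simp add: transpose_def vec_eq_iff forall_3)
  ultimately show "\<exists>Q. transpose Q = Q \<and> f = quadratic_form Q" by blast
next
  assume "\<exists>Q. transpose Q = Q \<and> f = quadratic_form Q"
  then obtain Q where f: "f = quadratic_form Q" and t: "transpose Q = Q" by blast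
  have s: "Q$i$j = Q$j$i" for i j
    using t by (auto simp: transpose_def vec_eq_iff)
  have e: "f x = Q$1$1 * (x$1)^2 + Q$2$2 * (x$2)^2 + Q$3$3 * (x$3)^2
      + 2 * Q$1$2 * x$1 * x$2 + 2 * Q$1$3 * x$1 * x$3 + 2 * Q$2$3 * x$2 * x$3" for x
    using s[of 2 1] s[of 3 1] s[of 3 2]
    by (simp add: f quadratic_form_def sum_3 algebra_simps power2_eq_square)
  show "homogeneous_polynomial 2 f"
    unfolding homogeneous_polynomial_def triples_sum
    by (rule exI[of _ "\<lambda>i j k. if i = 2 then Q$1$1 else if j = 2 then Q$2$2 else
          if k = 2 then Q$3$3 else if k = 0 then 2 * Q$1$2 else if j = 0 then 2 * Q$1$3
          else 2 * Q$2$3"]) (simp add: e)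
qed

lemma deriv2_quadratic: "(deriv ^^ 2) (\<lambda>t. p + q * t + r * t\<^sup>2) 0 = 2 * (r :: real)"
proof -
  have "deriv (\<lambda>t. p + q * t + r * t\<^sup>2) = (\<lambda>t. q + 2 * r * t)"
    by (rule ext, rule DERIV_imp_deriv) (auto intro!: derivative_eq_intros)
  moreover have "deriv (\<lambda>t. q + 2 * r * t) 0 = 2 * r"
    by (rule DERIV_imp_deriv) (auto intro!: derivative_eq_intros)
  ultimately show ?thesis by (simp add: numeral_2_eq_2)
qed

lemma laplacian_const: "laplacian (\<lambda>x. c) x = 0"
  using deriv2_quadratic[of c 0 0] by (simp add: laplacian_def)

lemma laplacian_linear_form: "laplacian (linear_form a) x = 0"
proof -
  have "(\<lambda>t. linear_form a (x + t *\<^sub>R axis i 1)) = (\<lambda>t. a \<bullet> x + (a \<bullet> axis i 1) * t + 0 * t\<^sup>2)" for i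
    by (auto simp: linear_form_inner inner_add_right)
  then show ?thesis unfolding laplacian_def by (simp only: deriv2_quadratic) simp
qed

lemma laplacian_quadratic_form: "laplacian (quadratic_form Q) x = 2 * trace Q"
proof -
  have "(\<lambda>t. quadratic_form Q (x + t *\<^sub>R axis i 1)) = (\<lambda>t. quadratic_form Q x
      + (x \<bullet> (Q *v axis i 1) + axis i 1 \<bullet> (Q *v x)) * t + (Q$i$i) * t\<^sup>2)" for i
  proof -
    have "axis i 1 \<bullet> (Q *v axis i 1) = Q$i$i"
      by (simp add: inner_axis' matrix_vector_mul_component inner_axis)
    then show ?thesis
      by (auto simp: quadratic_form_inner inner_add_left inner_add_right
          matrix_vector_right_distrib matrix_vector_mult_scaleR algebra_simps power2_eq_square)
  qed
  then show ?thesis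
    unfolding laplacian_def trace_def by (simp only: deriv2_quadratic sum_distrib_left)
qed

lemma harmonic_space_0: "harmonic_space 0 = range (\<lambda>c x. c)"
  by (auto simp: harmonic_space_def homogeneous_polynomial_0 laplacian_const)

lemma harmonic_space_1: "harmonic_space 1 = range linear_form"
  unfolding harmonic_space_def homogeneous_polynomial_1 by (auto simp: laplacian_linear_form)

lemma harmonic_space_2: "harmonic_space 2 = quadratic_form ` traceless_symmetric"
  by (auto simp: harmonic_space_def homogeneous_polynomial_2 laplacian_quadratic_form
      traceless_symmetric_def)

theorem bij_betw_to_harmonics: "bij_betw to_harmonics V2 harmonic_sum"
proof -
  have "to_harmonics ` V2 = harmonic_sum"
    unfolding harmonic_sum_def harmonic_space_0 harmonic_space_1 harmonic_space_2
    by (force simp: to_harmonics_def V2_def image_iff)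
  then show ?thesis by (simp add: bij_betw_def inj_on_to_harmonics)
qed

end

theory Submission
  imports Defs
begin

text \<open>Orbits are separated by diagonalising: a rotation carries \<open>Q\<close> to a diagonal matrix
  with decreasing entries \<open>l\<close>, and \<open>l\<close> is determined by its power sums, hence by
  \<open>tr Q\<^sup>2\<close> and \<open>det Q\<close>. For distinct entries a Vandermonde argument recovers
  every \<open>a\<^sub>i\<^sup>2\<close> from \<open>a\<^sup>T Q\<^sup>k a\<close>, and \<open>\<epsilon>\<close> fixes the sign of
  \<open>a\<^sub>1a\<^sub>2a\<^sub>3\<close>, so the remaining sign changes form a rotation; a repeated entry leaves
  a whole \<open>O(2)\<close> or \<open>SO(3)\<close> of rotations commuting with the diagonal matrix.

  The joint invariants come from the covering \<open>SL\<^sub>2(\<complex>) \<rightarrow> SO\<^sub>3(\<complex>)\<close>: the null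
  vector satisfies \<open>v(gz) = \<rho>(g) v(z)\<close> with \<open>\<rho>(g)\<close> complex orthogonal of
  determinant one, and every binary quadratic (quartic) is \<open>\<langle>x, v(z)\<rangle>\<close>
  (\<open>v(z)\<^sup>T M v(z)\<close> with \<open>M\<close> symmetric and traceless) for a unique complex \<open>x\<close>
  (\<open>M\<close>). Hence \<open>SO\<^sub>3(\<complex>)\<close>-invariants of \<open>(x, M)\<close> are joint invariants.\<close>

section \<open>Polynomial identities and invariance\<close>

lemmas coord_simps = vec_eq_iff forall_3 matrix_matrix_mult_def matrix_vector_mult_def sum_3
  transpose_def trace_def mat_def

lemma traceless_symmetric_entries:
  assumes "Q \<in> traceless_symmetric"
  shows "Q$2$1 = Q$1$2" "Q$3$1 = Q$1$3" "Q$3$2 = Q$2$3" "Q$3$3 = - Q$1$1 - Q$2$2"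
proof -
  have sym: "Q$i$j = Q$j$i" for i j
    using assms by (auto simp: traceless_symmetric_def transpose_def vec_eq_iff)
  show "Q$2$1 = Q$1$2" "Q$3$1 = Q$1$3" "Q$3$2 = Q$2$3"
    by (fact sym)+
  show "Q$3$3 = - Q$1$1 - Q$2$2"
    using assms by (simp add: traceless_symmetric_def trace_def sum_3)
qed

text \<open>For trace zero the second elementary symmetric function of the eigenvalues is -
  tr(Q^2)/2, so the characteristic polynomial is t^3 - (tr(Q^2)/2) t - det Q. The check is
  entrywise, after the dependent entries have been eliminated.\<close>

lemma cayley_hamilton_traceless_symmetric:
  assumes "Q \<in> traceless_symmetric"
  shows "Q ** Q ** Q = (trace (Q ** Q) / 2) *\<^sub>R Q + det Q *\<^sub>R mat 1"
  by (simp add: coord_simps det_3 traceless_symmetric_entries[OF assms] field_simps)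

lemma inner_symmetric_matrix:
  fixes Q :: "real^'n^'n"
  assumes "transpose Q = Q"
  shows "(Q *v x) \<bullet> y = x \<bullet> (Q *v y)"
  by (metis assms dot_lmul_matrix transpose_matrix_vector)

lemma Gram_eq: "Gram w = w ** transpose (w :: real^3^3)"
  by (simp add: Gram_def vec_eq_iff matrix_matrix_mult_def transpose_def inner_vec_def)

lemma det_Gram: "det (Gram w) = (det (transpose w))\<^sup>2" for w :: "real^3^3"
  by (simp add: Gram_eq det_mul det_transpose power2_eq_square)

text \<open>Symmetry of \<open>Q\<close> makes the inner product of Q^i a and Q^j a depend only on i
  + j, so the Gram matrix is the Hankel matrix of the moments s0, ..., s4. Cayley-Hamilton reduces
  s3 and s4 to the lower moments, and the right side is the expanded Hankel determinant.\<close>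

lemma det_Gram_krylov:
  fixes Q :: "real^3^3" and a :: "real^3"
  assumes "Q \<in> traceless_symmetric"
  defines "\<tau> \<equiv> trace (Q ** Q) / 2" and "s0 \<equiv> (norm a)\<^sup>2" and "s1 \<equiv> a \<bullet> (Q *v a)"
    and "s2 \<equiv> a \<bullet> ((Q ** Q) *v a)"
  defines "s3 \<equiv> \<tau> * s1 + det Q * s0" and "s4 \<equiv> \<tau> * s2 + det Q * s1"
  shows "det (Gram (vector [a, Q *v a, (Q ** Q) *v a])) =
    s0 * s2 * s4 + 2 * s1 * s2 * s3 - s2 * s2 * s2 - s0 * s3 * s3 - s1 * s1 * s4"
proof -
  have sym: "transpose Q = Q"
    using assms(1) by (simp add: traceless_symmetric_def)
  have cube: "Q *v (Q *v (Q *v x)) = \<tau> *\<^sub>R (Q *v x) + det Q *\<^sub>R x" for x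
    using arg_cong[OF cayley_hamilton_traceless_symmetric[OF assms(1)], of "\<lambda>M. M *v x"]
    by (simp add: \<tau>_def matrix_vector_mul_assoc[symmetric] matrix_vector_mult_add_rdistrib
        scaleR_matrix_vector_assoc[symmetric])
  define b c where "b = Q *v a" and "c = Q *v b"
  have aa: "a \<bullet> a = s0" and ab: "a \<bullet> b = s1" and ac: "a \<bullet> c = s2"
    by (simp_all add: s0_def s1_def s2_def dot_square_norm b_def c_def matrix_vector_mul_assoc)
  \<comment> \<open>Each rule moves one factor \<open>Q\<close> to the other side of the inner
    product, which turns every Gram entry into one of the moments.\<close>
  have move: "b \<bullet> y = a \<bullet> (Q *v y)" "c \<bullet> y = b \<bullet> (Q *v y)" for y
    by (simp_all add: b_def c_def inner_symmetric_matrix[OF sym])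
  have Qc: "Q *v c = \<tau> *\<^sub>R b + det Q *\<^sub>R a" "Q *v b = c" "Q *v a = b"
    by (simp_all add: b_def c_def cube)
  have bb: "b \<bullet> b = s2"
    by (simp only: move Qc ac)
  have bc: "b \<bullet> c = s3"
    by (simp only: move(1) Qc inner_add_right inner_scaleR_right aa ab s3_def)
  have cc: "c \<bullet> c = s4"
    by (simp only: move(2) Qc inner_add_right inner_scaleR_right bb inner_commute[of b a] ab s4_def)
  have "Gram (vector [a, b, c]) = vector [vector [s0, s1, s2], vector [s1, s2, s3], vector [s2, s3, s4]]"
    using aa ab ac bb bc cc inner_commute[of b a] inner_commute[of c a] inner_commute[of c b]
    by (simp add: Gram_def vec_eq_iff forall_3)
  then have "det (Gram (vector [a, b, c])) =
      s0 * s2 * s4 + 2 * s1 * s2 * s3 - s2 * s2 * s2 - s0 * s3 * s3 - s1 * s1 * s4"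
    by (simp add: det_3 algebra_simps)
  then show ?thesis
    by (simp add: b_def c_def matrix_vector_mul_assoc)
qed

lemma inv_eps_squared:
  "(inv_eps (f0, a, Q))\<^sup>2 = det (Gram (vector [a, Q *v a, (Q ** Q) *v a]))"
  by (simp add: inv_eps_def det_Gram)

lemma ex_gram_polynomial:
  "\<exists>P :: real \<times> real \<times> real \<times> real \<times> real \<times> real \<Rightarrow> real. real_polynomial_function P \<and>
     (\<forall>f0 a Q. (f0, a, Q) \<in> V2 \<longrightarrow>
        det (Gram (vector [a, Q *v a, (Q ** Q) *v a])) =
        P (inv_f0 (f0, a, Q), inv_aa (f0, a, Q), inv_trQ2 (f0, a, Q),
           inv_detQ (f0, a, Q), inv_aQa (f0, a, Q), inv_aQ2a (f0, a, Q)))"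
proof -
  \<comment> \<open>The six arguments come in the order of the invariants in the claim. The factor
    1/2 turns the third one, tr(Q^2), into the Cayley-Hamilton coefficient
    \<open>\<tau>\<close>.\<close>
  define \<tau> d s0 s1 s2 :: "real \<times> real \<times> real \<times> real \<times> real \<times> real \<Rightarrow> real"
    where "\<tau> = (\<lambda>p. (1/2) * fst (snd (snd p)))" and "d = (\<lambda>p. fst (snd (snd (snd p))))"
      and "s0 = (\<lambda>p. fst (snd p))" and "s1 = (\<lambda>p. fst (snd (snd (snd (snd p)))))"
      and "s2 = (\<lambda>p. snd (snd (snd (snd (snd p)))))"
  define s3 where "s3 = (\<lambda>p. \<tau> p * s1 p + d p * s0 p)"
  define s4 where "s4 = (\<lambda>p. \<tau> p * s2 p + d p * s1 p)"
  define P where "P = (\<lambda>p. s0 p * s2 p * s4 p + 2 * s1 p * s2 p * s3 p - s2 p * s2 p * s2 p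
      - s0 p * s3 p * s3 p - s1 p * s1 p * s4 p)"
  have lin: "real_polynomial_function \<tau>" "real_polynomial_function d" "real_polynomial_function s0"
    "real_polynomial_function s1" "real_polynomial_function s2"
    by (auto intro!: real_polynomial_function.intros(1)
        simp: \<tau>_def d_def s0_def s1_def s2_def linear_iff algebra_simps
        simp flip: linear_conv_bounded_linear)
  have lin': "real_polynomial_function s3" "real_polynomial_function s4"
    unfolding s3_def s4_def by (intro real_polynomial_function.intros(3-4) lin)+
  have "real_polynomial_function P"
    unfolding P_def
    by (intro real_polynomial_function.intros(2-4) real_polynomial_function_diff lin lin')
  then show ?thesis
    by (rule exI[of _ P, OF conjI])
       (simp add: det_Gram_krylov V2_def P_def s3_def s4_def \<tau>_def d_def s0_def s1_def s2_def
          inv_aa_def inv_trQ2_def inv_detQ_def inv_aQa_def inv_aQ2a_def)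
qed

section \<open>Polynomiality and degrees of the seven invariants\<close>

lemma polynomial_coordinates:
  "real_polynomial_function (\<lambda>c :: coords. fst c)"
  "real_polynomial_function (\<lambda>c :: coords. fst (snd c) $ i)"
  "real_polynomial_function (\<lambda>c :: coords. snd (snd c) $ i $ j)"
  by (auto intro!: real_polynomial_function.intros(1) simp: linear_iff
      simp flip: linear_conv_bounded_linear)

lemma polynomial_on_V2I: "real_polynomial_function \<phi> \<Longrightarrow> polynomial_on_V2 \<phi>"
  by (auto simp: polynomial_on_V2_def)

text \<open>Projections and finite sums replace pattern matching, norm and trace, so that the
  closure rules of \<open>real_polynomial_function\<close> apply directly to the unfolded right
  sides.\<close>

lemma inv_coordinates:
  "inv_f0 c = fst c"
  "inv_aa c = (\<Sum>i\<in>UNIV. fst (snd c) $ i * fst (snd c) $ i)"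
  "inv_trQ2 c = (\<Sum>i\<in>UNIV. \<Sum>j\<in>UNIV. snd (snd c) $ i $ j * snd (snd c) $ j $ i)"
  "inv_detQ c = det (snd (snd c))"
  "inv_aQa c = (\<Sum>i\<in>UNIV. fst (snd c) $ i * (snd (snd c) *v fst (snd c)) $ i)"
  "inv_aQ2a c = (\<Sum>i\<in>UNIV. fst (snd c) $ i * ((snd (snd c) ** snd (snd c)) *v fst (snd c)) $ i)"
  "inv_eps c = det (transpose (vector [fst (snd c), snd (snd c) *v fst (snd c),
     (snd (snd c) ** snd (snd c)) *v fst (snd c)] :: real^3^3))"
  by (simp_all add: inv_f0_def inv_aa_def inv_trQ2_def inv_detQ_def inv_aQa_def inv_aQ2a_def
      inv_eps_def case_prod_beta trace_def matrix_matrix_mult_def inner_vec_def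
      flip: dot_square_norm)

lemma polynomial_on_V2_invariants:
  assumes "\<phi> \<in> {inv_f0, inv_aa, inv_trQ2, inv_detQ, inv_aQa, inv_aQ2a, inv_eps}"
  shows "polynomial_on_V2 \<phi>"
proof -
  have "real_polynomial_function inv_f0" "real_polynomial_function inv_aa"
    "real_polynomial_function inv_trQ2" "real_polynomial_function inv_detQ"
    "real_polynomial_function inv_aQa" "real_polynomial_function inv_aQ2a"
    "real_polynomial_function inv_eps"
    unfolding inv_coordinates[abs_def] det_3 sum_3 matrix_vector_mult_def matrix_matrix_mult_def
      transpose_def vec_lambda_beta vector_3
    by (intro polynomial_coordinates real_polynomial_function.intros(3-4)
        real_polynomial_function_diff)+
  with assms show ?thesis
    by (auto intro: polynomial_on_V2I)
qed

text \<open>The three columns scale by s, s t and s t^2. A general commutative ring serves both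
  uses: degree 6 over the reals with s = t, and bidegree (3,3) over the complex numbers.\<close>

lemma det_krylov_scale:
  fixes a :: "('a::comm_ring_1)^3"
  shows "det (transpose (vector [s *s a, (\<chi> i j. t * Q$i$j) *v (s *s a),
      ((\<chi> i j. t * Q$i$j) ** (\<chi> i j. t * Q$i$j)) *v (s *s a)]))
    = s ^ 3 * t ^ 3 * det (transpose (vector [a, Q *v a, (Q ** Q) *v a]))"
proof -
  have 1: "(\<chi> i j. t * Q$i$j) *v (s *s x) = (s * t) *s (Q *v x)" for s and x :: "'a^3"
    by (simp add: vec_eq_iff matrix_vector_mult_def sum_3 algebra_simps)
  show ?thesis
    by (simp add: matrix_vector_mul_assoc[symmetric] 1 det_3 transpose_def)
       (simp add: algebra_simps power3_eq_cube)
qed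

lemma invariants_scale:
  "inv_f0 (t *\<^sub>R c) = t * inv_f0 c" "inv_aa (t *\<^sub>R c) = t\<^sup>2 * inv_aa c"
  "inv_trQ2 (t *\<^sub>R c) = t\<^sup>2 * inv_trQ2 c" "inv_detQ (t *\<^sub>R c) = t ^ 3 * inv_detQ c"
  "inv_aQa (t *\<^sub>R c) = t ^ 3 * inv_aQa c" "inv_aQ2a (t *\<^sub>R c) = t ^ 4 * inv_aQ2a c"
  "inv_eps (t *\<^sub>R c) = t ^ 6 * inv_eps c"
proof -
  obtain f0 a Q where c: "c = (f0, a, Q)" by (cases c)
  have Q: "t *\<^sub>R Q = (\<chi> i j. t * Q$i$j)" and a: "t *\<^sub>R a = t *s a"
    by (simp_all add: vec_eq_iff)
  show "inv_eps (t *\<^sub>R c) = t ^ 6 * inv_eps c"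
    by (simp add: c inv_eps_def Q a det_krylov_scale del: det_transpose flip: power_add)
qed (simp_all add: inv_coordinates coord_simps det_3 algebra_simps eval_nat_numeral)

text \<open>A generic point: the eigenvalues are distinct and nonzero and no coordinate of the
  vector vanishes, hence \<open>inv_eps\<close> is nonzero here.\<close>

definition sample :: coords where
  "sample = (1, vector [1, 1, 1],
     vector [vector [1, 0, 0], vector [0, 2, 0], vector [0, 0, -3]])"

lemma sample_V2: "sample \<in> V2"
  by (simp add: sample_def V2_def traceless_symmetric_def coord_simps)

lemma sample_values:
  "inv_f0 sample \<noteq> 0" "inv_aa sample \<noteq> 0" "inv_trQ2 sample \<noteq> 0" "inv_detQ sample \<noteq> 0"
  "inv_aQ2a sample \<noteq> 0" "inv_eps sample \<noteq> 0"
  by (simp_all add: sample_def inv_coordinates coord_simps det_3)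

text \<open>At \<open>sample\<close> this invariant is the sum of the eigenvalues, which is zero, so
  it gets a witness of its own: an eigenvector with eigenvalue 1.\<close>

lemma inv_aQa_nonzero: "\<exists>c\<in>V2. inv_aQa c \<noteq> 0"
proof
  let ?c = "(0, vector [1, 0, 0],
     vector [vector [1, 0, 0], vector [0, 2, 0], vector [0, 0, -3]]) :: coords"
  show "?c \<in> V2" by (simp add: V2_def traceless_symmetric_def coord_simps)
  show "inv_aQa ?c \<noteq> 0" by (simp add: inv_coordinates coord_simps)
qed

lemma polynomial_of_degree_invariants:
  "polynomial_of_degree 1 inv_f0" "polynomial_of_degree 2 inv_aa" "polynomial_of_degree 2 inv_trQ2"
  "polynomial_of_degree 3 inv_detQ" "polynomial_of_degree 3 inv_aQa"
  "polynomial_of_degree 4 inv_aQ2a" "polynomial_of_degree 6 inv_eps"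
  using sample_V2 sample_values inv_aQa_nonzero
  by (auto simp: polynomial_of_degree_def polynomial_on_V2_invariants invariants_scale)

section \<open>Behaviour under orthogonal matrices\<close>

lemma linear_form_orthogonal:
  assumes "transpose R ** R = mat 1"
  shows "linear_form (R *v x) (R *v y) = linear_form x (y :: ('a::comm_ring_1)^3)"
proof -
  have adj: "linear_form (R *v x) z = linear_form x (transpose R *v z)" for z
    by (simp add: linear_form_def matrix_vector_mult_def transpose_def sum_3 algebra_simps)
  show ?thesis
    by (simp add: adj matrix_vector_mul_assoc assms del: transpose_matrix_vector)
qed

text \<open>Products of \<open>Q\<close> and their values on the vector transform by the same rule
  as \<open>Q\<close> and the vector themselves. The ring is arbitrary because complex orthogonal
  matrices are used later on as well.\<close>

lemma conjugate_mult:
  fixes Q :: "('a::comm_ring_1)^'n^'n"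
  assumes "transpose R ** R = mat 1"
  shows "(R ** Q ** transpose R) *v (R *v x) = R *v (Q *v x)"
    "(R ** Q ** transpose R) ** (R ** M ** transpose R) = R ** (Q ** M) ** transpose R"
proof -
  have 1: "transpose R *v (R *v y) = y" for y
    by (simp add: matrix_vector_mul_assoc assms del: transpose_matrix_vector)
  show "(R ** Q ** transpose R) *v (R *v x) = R *v (Q *v x)"
    by (simp add: matrix_vector_mul_assoc[symmetric] 1 del: transpose_matrix_vector)
  have "(R ** Q ** transpose R) ** (R ** M ** transpose R)
      = R ** Q ** (transpose R ** R) ** M ** transpose R"
    by (simp only: matrix_mul_assoc)
  then show "(R ** Q ** transpose R) ** (R ** M ** transpose R) = R ** (Q ** M) ** transpose R"
    by (simp add: assms matrix_mul_assoc)
qed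

lemma det_columns_mult:
  fixes R :: "('a::comm_ring_1)^3^3"
  shows "det (transpose (vector [R *v x, R *v y, R *v z])) = det R * det (transpose (vector [x, y, z]))"
proof -
  have "transpose (vector [R *v x, R *v y, R *v z] :: 'a^3^3) = R ** transpose (vector [x, y, z])"
  proof -
    have "transpose (vector [R *v x, R *v y, R *v z] :: 'a^3^3) $ i $ j =
        (R ** transpose (vector [x, y, z])) $ i $ j"
      for i j :: 3
      using exhaust_3[of j]
      by (auto simp: transpose_def matrix_matrix_mult_def matrix_vector_mult_def)
    then show ?thesis by (simp add: vec_eq_iff)
  qed
  then show ?thesis by (simp add: det_mul)
qed

text \<open>Each Q^k a is carried to R Q^k a. Inner products, traces and det Q do not see
  \<open>R\<close>, while the determinant of three such vectors picks up det R; one formula thus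
  covers rotations and improper elements.\<close>

lemma invariants_act:
  assumes "orthogonal_matrix R"
  shows "inv_f0 (act R c) = inv_f0 c" "inv_aa (act R c) = inv_aa c"
    "inv_trQ2 (act R c) = inv_trQ2 c" "inv_detQ (act R c) = inv_detQ c"
    "inv_aQa (act R c) = inv_aQa c" "inv_aQ2a (act R c) = inv_aQ2a c"
    "inv_eps (act R c) = det R * inv_eps c"
proof -
  obtain f0 a Q where c: "c = (f0, a, Q)" by (cases c)
  have R: "transpose R ** R = mat 1" "R ** transpose R = mat 1"
    using assms by (auto simp: orthogonal_matrix_def)
  have inner: "(R *v x) \<bullet> (R *v y) = x \<bullet> y" for x y
    using linear_form_orthogonal[OF R(1), of x y] by (simp add: linear_form_inner)
  have trace: "trace (R ** M ** transpose R) = trace M" for M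
    using trace_mul_sym[of "R ** M" "transpose R"] by (simp add: matrix_mul_assoc R)
  have "(det R)\<^sup>2 = 1"
    using arg_cong[OF R(1), of det] by (simp add: det_mul det_transpose power2_eq_square)
  then show "inv_detQ (act R c) = inv_detQ c"
    by (simp add: c inv_detQ_def act_def det_mul det_transpose power2_eq_square)
  show "inv_f0 (act R c) = inv_f0 c" "inv_aa (act R c) = inv_aa c"
    "inv_trQ2 (act R c) = inv_trQ2 c" "inv_aQa (act R c) = inv_aQa c"
    "inv_aQ2a (act R c) = inv_aQ2a c" "inv_eps (act R c) = det R * inv_eps c"
    by (simp_all add: c act_def inv_f0_def inv_aa_def inv_trQ2_def inv_aQa_def inv_aQ2a_def
        inv_eps_def conjugate_mult[OF R(1)] inner trace det_columns_mult del: det_transpose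
        flip: dot_square_norm)
qed

lemma O3_invariant_invariants:
  assumes "\<phi> \<in> {inv_f0, inv_aa, inv_trQ2, inv_detQ, inv_aQa, inv_aQ2a}"
  shows "O3_invariant \<phi>"
  using assms
  by (auto simp: O3_invariant_def SO3_invariant_def polynomial_on_V2_invariants invariants_act
      rotation_matrix_def rotoinversion_matrix_def)

lemma pseudo_invariant_eps: "pseudo_invariant inv_eps"
  by (auto simp: pseudo_invariant_def SO3_invariant_def polynomial_on_V2_invariants invariants_act
      rotation_matrix_def rotoinversion_matrix_def)

section \<open>Separation of orbits\<close>

text \<open>A maximiser of the quadratic form on the compact unit sphere of an invariant subspace is
  an eigenvector. The bound by the maximum is kept in the conclusion because it later orders the
  eigenvalues.\<close>

lemma ex_eigenvector_in_subspace:
  fixes Q :: "real^'n^'n"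
  assumes sym: "transpose Q = Q" and S: "subspace S" and inv: "\<And>x. x \<in> S \<Longrightarrow> Q *v x \<in> S"
    and v: "v \<in> S" "v \<noteq> 0"
  shows "\<exists>u\<in>S. \<exists>l. norm u = 1 \<and> Q *v u = l *\<^sub>R u \<and>
    (\<forall>x\<in>S. x \<bullet> (Q *v x) \<le> l * (norm x)\<^sup>2)"
proof -
  let ?q = "\<lambda>x. x \<bullet> (Q *v x)" and ?K = "S \<inter> sphere 0 1"
  have "compact ?K"
    by (intro closed_Int_compact closed_subspace S compact_sphere)
  moreover have "v /\<^sub>R norm v \<in> ?K"
    using v by (simp add: subspace_mul[OF S])
  moreover have "continuous_on ?K ?q"
    by (intro continuous_on_inner continuous_on_id matrix_vector_mult_linear_continuous_on)
  ultimately obtain u where u: "u \<in> ?K" and max: "\<And>y. y \<in> ?K \<Longrightarrow> ?q y \<le> ?q u"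
    using continuous_attains_sup[of ?K ?q] by blast
  define l where "l = ?q u"
  have uS: "u \<in> S" and nu: "norm u = 1"
    using u by auto
  have bound: "?q x \<le> l * (norm x)\<^sup>2" if "x \<in> S" for x
  proof (cases "x = 0")
    case False
    then have "?q (x /\<^sub>R norm x) \<le> l"
      using max[of "x /\<^sub>R norm x"] that by (simp add: l_def subspace_mul[OF S])
    then have "?q x / (norm x)\<^sup>2 \<le> l"
      by (simp add: matrix_vector_mult_scaleR power2_eq_square divide_inverse mult.commute mult.left_commute)
    with False show ?thesis
      by (simp add: divide_simps)
  qed simp
  \<comment> \<open>\<open>w\<close> is orthogonal to \<open>u\<close>, and maximality of the quadratic form at \<open>u\<close>,
    tested along \<open>u + t w\<close> for small \<open>t > 0\<close>, forces \<open>w = 0\<close>.\<close>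
  define w where "w = Q *v u - l *\<^sub>R u"
  have wS: "w \<in> S"
    unfolding w_def by (intro subspace_diff S subspace_mul inv uS)
  have uu: "u \<bullet> u = 1"
    using nu by (simp add: dot_square_norm)
  have uw: "u \<bullet> w = 0"
    by (simp add: w_def inner_diff_right uu l_def)
  have Qu: "Q *v u = w + l *\<^sub>R u"
    by (simp add: w_def)
  have "w = 0"
  proof (rule ccontr)
    assume "w \<noteq> 0"
    define n k where "n = w \<bullet> w" and "k = l * n - ?q w"
    have "n > 0"
      using \<open>w \<noteq> 0\<close> by (simp add: n_def)
    \<comment> \<open>With this \<open>t\<close> one has t k \<le> t (|k| + 1) = n, which
      contradicts 2 n \<le> t k. Adding 1 keeps the denominator positive.\<close>
    define t where "t = n / (\<bar>k\<bar> + 1)"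
    have "t > 0"
      using \<open>n > 0\<close> by (simp add: t_def)
    have "w \<bullet> (Q *v u) = n"
      by (simp add: Qu inner_add_right n_def uw inner_commute[of w u])
    moreover have "u \<bullet> (Q *v w) = n"
      using calculation inner_symmetric_matrix[OF sym, of u w] by (simp add: inner_commute)
    ultimately have "?q (u + t *\<^sub>R w) = l + 2 * t * n + t\<^sup>2 * ?q w"
      by (simp add: matrix_vector_right_distrib matrix_vector_mult_scaleR inner_add_left
          inner_add_right l_def power2_eq_square algebra_simps)
    moreover have "(norm (u + t *\<^sub>R w))\<^sup>2 = 1 + t\<^sup>2 * n"
      unfolding power2_norm_eq_inner
      by (simp add: inner_add_left inner_add_right uu uw inner_commute[of w u] n_def power2_eq_square)
    ultimately have "l + 2 * t * n + t\<^sup>2 * ?q w \<le> l * (1 + t\<^sup>2 * n)"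
      using bound[of "u + t *\<^sub>R w"] by (simp add: subspace_add subspace_mul S uS wS)
    then have "t * (2 * n) \<le> t * (t * k)"
      by (simp add: k_def power2_eq_square algebra_simps)
    then have "2 * n \<le> t * k"
      using \<open>t > 0\<close> by simp
    also have "\<dots> \<le> t * (\<bar>k\<bar> + 1)"
      using \<open>t > 0\<close> by (intro mult_left_mono) auto
    also have "\<dots> = n"
      by (simp add: t_def add_nonneg_eq_0_iff)
    finally show False
      using \<open>n > 0\<close> by simp
  qed
  then have "Q *v u = l *\<^sub>R u"
    by (simp add: Qu)
  with uS nu bound show ?thesis by blast
qed

definition diagonal :: "real^'n \<Rightarrow> real^'n^'n" where
  "diagonal l = (\<chi> i j. if i = j then l$i else 0)"

lemma conjugate_entry: "(U ** Q ** transpose U) $ i $ j = U$i \<bullet> (Q *v U$j)" for Q :: "real^3^3"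
  by (simp add: matrix_matrix_mult_def inner_vec_def matrix_vector_mult_def transpose_def sum_3
      algebra_simps)

text \<open>The rows of \<open>U\<close> are unit eigenvectors found one after another: in the whole
  space, in the plane orthogonal to \<open>u1\<close>, and on the line orthogonal to
  \<open>u1\<close> and \<open>u2\<close>.\<close>

lemma ex_rotation_diagonalizing:
  fixes Q :: "real^3^3"
  assumes sym: "transpose Q = Q"
  obtains U l where "rotation_matrix U" "U ** Q ** transpose U = diagonal l"
    "l$2 \<le> l$1" "l$3 \<le> l$2"
proof -
  have q: "x \<bullet> (Q *v x) = l" if "norm x = 1" "Q *v x = l *\<^sub>R x" for x l
    using that by (simp add: dot_square_norm)
  have perp: "u \<bullet> (Q *v x) = 0" if "Q *v u = l *\<^sub>R u" "u \<bullet> x = 0" for u x l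
    using that inner_symmetric_matrix[OF sym, of u x] by simp
  have orth_rows: "orthogonal_matrix (vector [x, y, z] :: real^3^3)"
    if "norm x = 1" "norm y = 1" "norm z = 1" "x \<bullet> y = 0" "x \<bullet> z = 0" "y \<bullet> z = 0" for x y z
    using that inner_commute[of y x] inner_commute[of z x] inner_commute[of z y]
    by (simp add: orthogonal_matrix_orthonormal_rows row_def forall_3 orthogonal_def)
  obtain u1 l1 where u1: "norm u1 = 1" "Q *v u1 = l1 *\<^sub>R u1"
    and max1: "\<And>x. x \<bullet> (Q *v x) \<le> l1 * (norm x)\<^sup>2"
    using ex_eigenvector_in_subspace[OF sym subspace_UNIV, of "axis 1 1"]
    by (simp add: axis_eq_0_iff) blast
  obtain v where v: "v \<noteq> 0" "u1 \<bullet> v = 0"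
    using orthogonal_to_vector_exists[of u1] by (auto simp: orthogonal_def)
  have S2: "subspace {x. u1 \<bullet> x = 0}"
    by (simp add: subspace_hyperplane)
  obtain u2 l2 where u2: "u1 \<bullet> u2 = 0" "norm u2 = 1" "Q *v u2 = l2 *\<^sub>R u2"
    and max2: "\<And>x. u1 \<bullet> x = 0 \<Longrightarrow> x \<bullet> (Q *v x) \<le> l2 * (norm x)\<^sup>2"
    using ex_eigenvector_in_subspace[OF sym S2, of v] v perp[OF u1(2)] by simp blast
  \<comment> \<open>The cross product shows that the line orthogonal to both vectors is not zero, as
    the eigenvector lemma requires.\<close>
  have "(norm (cross3 u1 u2))\<^sup>2 = 1"
    using norm_cross_dot[of u1 u2] u1 u2 by simp
  then have c: "cross3 u1 u2 \<noteq> 0" "u1 \<bullet> cross3 u1 u2 = 0" "u2 \<bullet> cross3 u1 u2 = 0"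
    by (auto simp: dot_cross_self)
  have S3: "subspace ({x. u1 \<bullet> x = 0} \<inter> {x. u2 \<bullet> x = 0})"
    by (intro subspace_inter subspace_hyperplane)
  obtain u3 l3 where u3: "u1 \<bullet> u3 = 0" "u2 \<bullet> u3 = 0" "norm u3 = 1" "Q *v u3 = l3 *\<^sub>R u3"
    using ex_eigenvector_in_subspace[OF sym S3, of "cross3 u1 u2"] c perp[OF u1(2)] perp[OF u2(3)]
    by simp blast
  have orth: "orthogonal_matrix (vector [u1, u2, u3])"
    by (rule orth_rows) (fact u1 u2 u3)+
  \<comment> \<open>Replacing \<open>u3\<close> by its negative keeps the eigenvalue and reverses
    the orientation, so one of the two choices gives determinant 1.\<close>
  obtain w where w: "u1 \<bullet> w = 0" "u2 \<bullet> w = 0" "norm w = 1" "Q *v w = l3 *\<^sub>R w"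
    and det: "det (vector [u1, u2, w] :: real^3^3) = 1"
  proof (cases "det (vector [u1, u2, u3] :: real^3^3) = 1")
    case True
    then show ?thesis using that u3 by blast
  next
    case False
    then have "det (vector [u1, u2, u3] :: real^3^3) = -1"
      using det_orthogonal_matrix[OF orth] by auto
    then have "det (vector [u1, u2, - u3] :: real^3^3) = 1"
      by (simp add: det_3)
    then show ?thesis
      using that[of "- u3"] u3 matrix_vector_mult_scaleR[of Q "-1" u3] by simp
  qed
  define U :: "real^3^3" where "U = vector [u1, u2, w]"
  define l :: "real^3" where "l = vector [l1, l2, l3]"
  have "orthogonal_matrix U"
    unfolding U_def by (rule orth_rows) (fact u1 u2 w)+
  then have "rotation_matrix U"
    using det by (simp add: rotation_matrix_def U_def)
  moreover have "U ** Q ** transpose U = diagonal l"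
  proof -
    have "u1 \<bullet> (Q *v u1) = l1" "u2 \<bullet> (Q *v u2) = l2" "w \<bullet> (Q *v w) = l3"
      using u1 u2 w q by blast+
    moreover have "u1 \<bullet> (Q *v u2) = 0" "u1 \<bullet> (Q *v w) = 0" "u2 \<bullet> (Q *v w) = 0"
      using u1 u2 w by simp_all
    moreover have "u2 \<bullet> (Q *v u1) = 0" "w \<bullet> (Q *v u1) = 0" "w \<bullet> (Q *v u2) = 0"
      using u1 u2 w by (simp_all add: inner_commute)
    ultimately show ?thesis
      by (simp add: vec_eq_iff conjugate_entry U_def l_def diagonal_def forall_3)
  qed
  \<comment> \<open>Each later eigenvector lies in the subspace over which an earlier one was
    maximal: \<open>u2\<close> in the whole space, \<open>w\<close> in the plane orthogonal to
    \<open>u1\<close>.\<close>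
  moreover have "l2 \<le> l1" "l3 \<le> l2"
    using max1[of u2] max2[OF w(1)] unfolding q[OF u2(2,3)] q[OF w(3,4)] u2(2) w(3) by simp_all
  ultimately show thesis
    using that[of U l] by (simp add: l_def)
qed

section \<open>Matching two diagonal representatives\<close>

lemma sorted_triple_eq:
  fixes l m :: "real^3"
  assumes "l$2 \<le> l$1" "l$3 \<le> l$2" "m$2 \<le> m$1" "m$3 \<le> m$2"
    and e1: "l$1 + l$2 + l$3 = m$1 + m$2 + m$3"
    and p2: "(l$1)\<^sup>2 + (l$2)\<^sup>2 + (l$3)\<^sup>2 = (m$1)\<^sup>2 + (m$2)\<^sup>2 + (m$3)\<^sup>2"
    and e3: "l$1 * l$2 * l$3 = m$1 * m$2 * m$3"
  shows "l = m"
proof -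
  have e2: "l$1 * l$2 + l$1 * l$3 + l$2 * l$3 = m$1 * m$2 + m$1 * m$3 + m$2 * m$3"
    using p2 arg_cong[OF e1, of "\<lambda>x. x\<^sup>2"] by (simp add: power2_eq_square algebra_simps)
  \<comment> \<open>The elementary symmetric functions of the two triples agree, so both are root
    lists of one monic cubic.\<close>
  have poly: "(t - l$1) * (t - l$2) * (t - l$3) = (t - m$1) * (t - m$2) * (t - m$3)" for t
  proof -
    have "(t - x) * (t - y) * (t - z) = t^3 - (x + y + z) * t\<^sup>2 + (x*y + x*z + y*z) * t - x*y*z"
      for x y z :: real
      by (simp add: power2_eq_square power3_eq_cube algebra_simps)
    then show ?thesis by (simp add: e1 e2 e3)
  qed
  \<comment> \<open>The largest root of each cubic is a root of the other, hence at most the other's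
    largest root. The smallest roots are compared in the same way, and the sum settles the middle
    one.\<close>
  have "l$1 = m$1"
    using poly[of "l$1"] poly[of "m$1"] assms(1-4) by auto
  moreover have "l$3 = m$3"
    using poly[of "l$3"] poly[of "m$3"] assms(1-4) by auto
  ultimately show ?thesis
    using e1 by (simp add: vec_eq_iff forall_3)
qed

text \<open>The sign \<open>e\<close> prescribes the determinant of the plane isometry:
  \<open>a2\<close> is first multiplied by \<open>e\<close>, then the rotation with cosine
  \<open>c\<close> and sine \<open>s\<close> is applied.\<close>

lemma ex_plane_isometry:
  fixes a1 a2 b1 b2 e :: real
  assumes eq: "a1\<^sup>2 + a2\<^sup>2 = b1\<^sup>2 + b2\<^sup>2" and e: "e * e = 1"
  obtains c s where "c * c + s * s = 1" "c * a1 - e * s * a2 = b1" "s * a1 + e * c * a2 = b2"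
proof (cases "a1\<^sup>2 + a2\<^sup>2 = 0")
  case True
  then show ?thesis
    using eq that[of 1 0] by (simp add: sum_power2_eq_zero_iff)
next
  case False
  \<comment> \<open>Here c + i s is the complex quotient of b1 + i b2 by a1 + i e a2, which has
    modulus one because the two lengths agree.\<close>
  define n c s where "n = a1\<^sup>2 + a2\<^sup>2" and "c = (a1 * b1 + e * a2 * b2) / n"
    and "s = (a1 * b2 - e * a2 * b1) / n"
  have n: "n \<noteq> 0"
    using False by (simp add: n_def)
  have "(a1 * b1 + e * a2 * b2)\<^sup>2 + (a1 * b2 - e * a2 * b1)\<^sup>2
      = (a1\<^sup>2 + (e * e) * a2\<^sup>2) * (b1\<^sup>2 + b2\<^sup>2)"
    by (simp add: power2_eq_square algebra_simps)
  also have "\<dots> = n * n"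
    by (simp add: n_def e flip: eq)
  finally have 1: "c * c + s * s = 1"
    using n by (simp add: c_def s_def power2_eq_square flip: add_divide_distrib)
  have "(a1 * b1 + e * a2 * b2) * a1 - e * (a1 * b2 - e * a2 * b1) * a2
      = (a1\<^sup>2 + (e * e) * a2\<^sup>2) * b1"
    by (simp add: power2_eq_square algebra_simps)
  then have 2: "c * a1 - e * s * a2 = b1"
    using n by (simp add: c_def s_def e n_def[symmetric] flip: diff_divide_distrib)
  have "(a1 * b2 - e * a2 * b1) * a1 + e * (a1 * b1 + e * a2 * b2) * a2
      = (a1\<^sup>2 + (e * e) * a2\<^sup>2) * b2"
    by (simp add: power2_eq_square algebra_simps)
  then have 3: "s * a1 + e * c * a2 = b2"
    using n by (simp add: c_def s_def e n_def[symmetric] flip: add_divide_distrib)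
  show ?thesis
    by (rule that[OF 1 2 3])
qed

lemma ex_sign:
  fixes x y :: real
  assumes "x\<^sup>2 = y\<^sup>2"
  obtains e where "e * e = 1" "y = e * x"
  using assms that[of 1] that[of "-1"] by (auto simp: power2_eq_iff)

lemma conjugate_commuting:
  assumes "orthogonal_matrix S" "S ** D = D ** S"
  shows "S ** D ** transpose S = (D :: real^'n^'n)"
  using assms by (simp add: orthogonal_matrix_def matrix_mul_assoc[symmetric])

lemma rotation_matrixI:
  assumes "R ** transpose R = mat 1" "det R = 1"
  shows "rotation_matrix (R :: real^'n^'n)"
  using assms by (simp add: rotation_matrix_def orthogonal_matrix_def matrix_left_right_inverse)

text \<open>Once \<open>Q\<close> is diagonal, only rotations commuting with it remain available.
  The equations assumed for \<open>\<alpha>\<close> and \<open>\<beta>\<close> are what the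
  invariants involving the vector say at the diagonal representatives; the cases follow the
  coincidences among the entries of \<open>l\<close>.\<close>

lemma ex_rotation_fixing_diagonal:
  fixes l \<alpha> \<beta> :: "real^3"
  assumes sorted: "l$2 \<le> l$1" "l$3 \<le> l$2" and sum0: "l$1 + l$2 + l$3 = 0"
    and s0: "(\<alpha>$1)\<^sup>2 + (\<alpha>$2)\<^sup>2 + (\<alpha>$3)\<^sup>2 = (\<beta>$1)\<^sup>2 + (\<beta>$2)\<^sup>2 + (\<beta>$3)\<^sup>2"
    and s1: "l$1 * (\<alpha>$1)\<^sup>2 + l$2 * (\<alpha>$2)\<^sup>2 + l$3 * (\<alpha>$3)\<^sup>2 =
      l$1 * (\<beta>$1)\<^sup>2 + l$2 * (\<beta>$2)\<^sup>2 + l$3 * (\<beta>$3)\<^sup>2"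
    and s2: "(l$1)\<^sup>2 * (\<alpha>$1)\<^sup>2 + (l$2)\<^sup>2 * (\<alpha>$2)\<^sup>2 + (l$3)\<^sup>2 * (\<alpha>$3)\<^sup>2 =
      (l$1)\<^sup>2 * (\<beta>$1)\<^sup>2 + (l$2)\<^sup>2 * (\<beta>$2)\<^sup>2 + (l$3)\<^sup>2 * (\<beta>$3)\<^sup>2"
    and eps: "(l$1 - l$2) * (l$1 - l$3) * (l$2 - l$3) * (\<alpha>$1 * \<alpha>$2 * \<alpha>$3) =
      (l$1 - l$2) * (l$1 - l$3) * (l$2 - l$3) * (\<beta>$1 * \<beta>$2 * \<beta>$3)"
  obtains S where "rotation_matrix S" "S *v \<alpha> = \<beta>" "S ** diagonal l ** transpose S = diagonal l"
proof -
  note found = that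
  \<comment> \<open>Lagrange interpolation on the three moment equations: for the first line they
    are weighted by the coefficients of (t - l2)(t - l3), which removes the terms of index 2 and 3.
    The other lines are analogous.\<close>
  have vand: "(l$1 - l$2) * (l$1 - l$3) * ((\<alpha>$1)\<^sup>2 - (\<beta>$1)\<^sup>2) = 0"
    "(l$2 - l$1) * (l$2 - l$3) * ((\<alpha>$2)\<^sup>2 - (\<beta>$2)\<^sup>2) = 0"
    "(l$3 - l$1) * (l$3 - l$2) * ((\<alpha>$3)\<^sup>2 - (\<beta>$3)\<^sup>2) = 0"
    using s0 s1 s2 by algebra+
  have main: thesis if "S ** transpose S = mat 1" "det S = 1" "S *v \<alpha> = \<beta>"
    "S ** diagonal l = diagonal l ** S" for S
  proof -
    have rot: "rotation_matrix S"
      using that by (intro rotation_matrixI)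
    then have "S ** diagonal l ** transpose S = diagonal l"
      using that(4) by (intro conjugate_commuting) (simp_all add: rotation_matrix_def)
    then show thesis
      by (rule found[OF rot that(3)])
  qed
  consider "l$1 = l$2" "l$2 = l$3" | "l$1 = l$2" "l$3 < l$2" | "l$2 < l$1" "l$2 = l$3"
    | "l$2 < l$1" "l$3 < l$2"
    using sorted by linarith
  then show thesis
  proof cases
    case 1
    \<comment> \<open>Three equal entries with sum zero all vanish. Every rotation then fixes the
      matrix, and equal norms of the vectors suffice.\<close>
    then have l: "diagonal l = 0"
      using sum0 by (simp add: diagonal_def vec_eq_iff forall_3)
    have "norm \<alpha> = norm \<beta>"
      using s0 by (simp add: norm_eq_sqrt_inner inner_vec_def sum_3 power2_eq_square)
    then obtain f where "orthogonal_transformation f" "det (matrix f) = 1" "f \<alpha> = \<beta>"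
      using rotation_exists[of \<alpha> \<beta>] by auto
    then have "rotation_matrix (matrix f)" "matrix f *v \<alpha> = \<beta>"
      by (auto simp: rotation_matrix_def orthogonal_transformation_matrix matrix_works
          orthogonal_transformation_linear)
    then show thesis
      using that l by simp
  next
    case 2
    have "(\<alpha>$3)\<^sup>2 = (\<beta>$3)\<^sup>2"
      using vand(3) 2 by simp
    then obtain e where e: "e * e = 1" "\<beta>$3 = e * \<alpha>$3"
      by (rule ex_sign)
    have "(\<alpha>$1)\<^sup>2 + (\<alpha>$2)\<^sup>2 = (\<beta>$1)\<^sup>2 + (\<beta>$2)\<^sup>2"
      using s0 \<open>(\<alpha>$3)\<^sup>2 = (\<beta>$3)\<^sup>2\<close> by simp
    then obtain c s where cs: "c * c + s * s = 1" "c * \<alpha>$1 - e * s * \<alpha>$2 = \<beta>$1"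
      "s * \<alpha>$1 + e * c * \<alpha>$2 = \<beta>$2"
      using e(1) by (rule ex_plane_isometry)
    \<comment> \<open>The sign on the isolated third axis is dictated by \<open>\<alpha>\<close> and
      \<open>\<beta>\<close>. The plane block has the same determinant \<open>e\<close>, so the
      whole matrix has determinant e^2 = 1.\<close>
    let ?S = "vector [vector [c, - e * s, 0], vector [s, e * c, 0], vector [0, 0, e]] :: real^3^3"
    have "c * c + e * s * (e * s) = 1" "s * s + e * c * (e * c) = 1"
      using cs(1) e(1) by algebra+
    then have "?S ** transpose ?S = mat 1"
      using cs(1) e(1) by (simp add: coord_simps)
    moreover have "det ?S = 1"
    proof -
      have "det ?S = (c * c + s * s) * (e * e)"
        by (simp add: det_3 algebra_simps)
      then show ?thesis by (simp add: cs(1) e(1))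
    qed
    moreover have "?S *v \<alpha> = \<beta>"
      using cs e by (simp add: coord_simps)
    moreover have "?S ** diagonal l = diagonal l ** ?S"
      using 2 by (simp add: coord_simps diagonal_def)
    ultimately show thesis
      by (rule main)
  next
    case 3
    have "(\<alpha>$1)\<^sup>2 = (\<beta>$1)\<^sup>2"
      using vand(1) 3 by simp
    then obtain e where e: "e * e = 1" "\<beta>$1 = e * \<alpha>$1"
      by (rule ex_sign)
    have "(\<alpha>$2)\<^sup>2 + (\<alpha>$3)\<^sup>2 = (\<beta>$2)\<^sup>2 + (\<beta>$3)\<^sup>2"
      using s0 \<open>(\<alpha>$1)\<^sup>2 = (\<beta>$1)\<^sup>2\<close> by simp
    then obtain c s where cs: "c * c + s * s = 1" "c * \<alpha>$2 - e * s * \<alpha>$3 = \<beta>$2"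
      "s * \<alpha>$2 + e * c * \<alpha>$3 = \<beta>$3"
      using e(1) by (rule ex_plane_isometry)
    \<comment> \<open>The same construction with the first axis isolated.\<close>
    let ?S = "vector [vector [e, 0, 0], vector [0, c, - e * s], vector [0, s, e * c]] :: real^3^3"
    have "c * c + e * s * (e * s) = 1" "s * s + e * c * (e * c) = 1"
      using cs(1) e(1) by algebra+
    then have "?S ** transpose ?S = mat 1"
      using cs(1) e(1) by (simp add: coord_simps)
    moreover have "det ?S = 1"
    proof -
      have "det ?S = (c * c + s * s) * (e * e)"
        by (simp add: det_3 algebra_simps)
      then show ?thesis by (simp add: cs(1) e(1))
    qed
    moreover have "?S *v \<alpha> = \<beta>"
      using cs e by (simp add: coord_simps)
    moreover have "?S ** diagonal l = diagonal l ** ?S"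
      using 3 by (simp add: coord_simps diagonal_def)
    ultimately show thesis
      by (rule main)
  next
    case 4
    have sq: "(\<alpha>$1)\<^sup>2 = (\<beta>$1)\<^sup>2" "(\<alpha>$2)\<^sup>2 = (\<beta>$2)\<^sup>2" "(\<alpha>$3)\<^sup>2 = (\<beta>$3)\<^sup>2"
      using vand 4 by simp_all
    have prod: "\<alpha>$1 * \<alpha>$2 * \<alpha>$3 = \<beta>$1 * \<beta>$2 * \<beta>$3"
      using eps 4 by simp
    \<comment> \<open>If some \<open>\<alpha>\<^sub>i\<close> vanishes, its sign is free and absorbs the determinant.\<close>
    obtain e :: "real^3" where e: "e$1 * e$1 = 1" "e$2 * e$2 = 1" "e$3 * e$3 = 1"
      "\<beta>$1 = e$1 * \<alpha>$1" "\<beta>$2 = e$2 * \<alpha>$2" "\<beta>$3 = e$3 * \<alpha>$3" "e$1 * e$2 * e$3 = 1"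
    proof -
      obtain x where x: "x * x = 1" "\<beta>$1 = x * \<alpha>$1" using sq(1) by (rule ex_sign)
      obtain y where y: "y * y = 1" "\<beta>$2 = y * \<alpha>$2" using sq(2) by (rule ex_sign)
      obtain z where z: "z * z = 1" "\<beta>$3 = z * \<alpha>$3" using sq(3) by (rule ex_sign)
      have sgn: "(y * z) * (y * z) = 1" "(x * z) * (x * z) = 1" "(x * y) * (x * y) = 1"
        using x(1) y(1) z(1) by algebra+
      \<comment> \<open>These are the products of the three signs after the sign at a vanishing
        coordinate has been replaced by the product of the other two.\<close>
      have triple: "y * z * y * z = 1" "x * (x * z) * z = 1" "x * y * (x * y) = 1"
        using x(1) y(1) z(1) by algebra+
      have "\<alpha>$1 * \<alpha>$2 * \<alpha>$3 * (x * y * z - 1) = 0"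
        using prod x y z by (simp add: algebra_simps)
      then consider "\<alpha>$1 = 0" | "\<alpha>$2 = 0" | "\<alpha>$3 = 0" | "x * y * z = 1"
        by auto
      then show thesis
      proof cases
        case 1
        then show thesis
          using that[of "vector [y * z, y, z]"] x y z sgn triple by simp
      next
        case 2
        then show thesis
          using that[of "vector [x, x * z, z]"] x y z sgn triple by simp
      next
        case 3
        then show thesis
          using that[of "vector [x, y, x * y]"] x y z sgn triple by simp
      next
        case 4
        then show thesis
          using that[of "vector [x, y, z]"] x y z by simp
      qed
    qed
    have "diagonal e ** transpose (diagonal e) = mat 1"
      using e by (simp add: coord_simps diagonal_def)
    moreover have "det (diagonal e) = 1"
      using e by (simp add: det_3 diagonal_def)
    moreover have "diagonal e *v \<alpha> = \<beta>"
      using e by (simp add: coord_simps diagonal_def)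
    moreover have "diagonal e ** diagonal l = diagonal l ** diagonal e"
      by (simp add: coord_simps diagonal_def)
    ultimately show thesis
      by (rule main)
  qed
qed

text \<open>For \<open>inv_eps\<close>, the matrix with columns a, Qa, Q^2 a is the diagonal matrix
  of \<open>\<alpha>\<close> times the Vandermonde matrix of \<open>l\<close>. The minus sign comes
  from reversing all three differences.\<close>

lemma invariants_diagonal:
  "inv_aa (f0, \<alpha>, diagonal l) = (\<alpha>$1)\<^sup>2 + (\<alpha>$2)\<^sup>2 + (\<alpha>$3)\<^sup>2"
  "inv_trQ2 (f0, \<alpha>, diagonal l) = (l$1)\<^sup>2 + (l$2)\<^sup>2 + (l$3)\<^sup>2"
  "inv_detQ (f0, \<alpha>, diagonal l) = l$1 * l$2 * l$3"
  "inv_aQa (f0, \<alpha>, diagonal l) = l$1 * (\<alpha>$1)\<^sup>2 + l$2 * (\<alpha>$2)\<^sup>2 + l$3 * (\<alpha>$3)\<^sup>2"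
  "inv_aQ2a (f0, \<alpha>, diagonal l) =
     (l$1)\<^sup>2 * (\<alpha>$1)\<^sup>2 + (l$2)\<^sup>2 * (\<alpha>$2)\<^sup>2 + (l$3)\<^sup>2 * (\<alpha>$3)\<^sup>2"
  "inv_eps (f0, \<alpha>, diagonal l) =
     - ((l$1 - l$2) * (l$1 - l$3) * (l$2 - l$3) * (\<alpha>$1 * \<alpha>$2 * \<alpha>$3))"
  by (simp_all add: inv_coordinates diagonal_def det_3 matrix_matrix_mult_def matrix_vector_mult_def
      sum_3 transpose_def power2_eq_square algebra_simps)

section \<open>From diagonal representatives back to orbits\<close>

lemma act_act: "act R (act S c) = act (R ** S) c"
  by (simp add: act_def case_prod_beta matrix_vector_mul_assoc matrix_mul_assoc matrix_transpose_mul)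

lemma act_id: "act (mat 1) c = c"
  by (simp add: act_def case_prod_beta)

lemma rotation_matrix_mult: "rotation_matrix R \<Longrightarrow> rotation_matrix S \<Longrightarrow> rotation_matrix (R ** S)"
  for R :: "real^'n^'n"
  by (auto simp: rotation_matrix_def det_mul intro: orthogonal_matrix_mul)

lemma rotation_matrix_transpose: "rotation_matrix R \<Longrightarrow> rotation_matrix (transpose R)"
  by (simp add: rotation_matrix_def)

lemma ex_diagonal_representative:
  assumes "c \<in> V2"
  obtains U f0 \<alpha> l where "rotation_matrix U" "act U c = (f0, \<alpha>, diagonal l)" "f0 = inv_f0 c"
    "l$2 \<le> l$1" "l$3 \<le> l$2" "l$1 + l$2 + l$3 = 0"
proof -
  obtain f0 a Q where c: "c = (f0, a, Q)" by (cases c)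
  have "transpose Q = Q"
    using assms by (simp add: c V2_def traceless_symmetric_def)
  then obtain U l where U: "rotation_matrix U" "U ** Q ** transpose U = diagonal l"
    and sorted: "l$2 \<le> l$1" "l$3 \<le> l$2"
    by (rule ex_rotation_diagonalizing)
  have act: "act U c = (f0, U *v a, diagonal l)"
    by (simp add: c act_def U)
  \<comment> \<open>Stability of \<open>V2\<close> transfers the trace condition to the
    eigenvalues.\<close>
  have "act U c \<in> V2"
    using U(1) assms by (simp add: act_V2 rotation_matrix_def)
  then have "l$1 + l$2 + l$3 = 0"
    by (simp add: act V2_def traceless_symmetric_def diagonal_def trace_def sum_3)
  then show thesis
    using that[OF U(1) act _ sorted] by (simp add: c inv_f0_def)
qed

lemma separates_SO3_orbits_invariants:
  "separates_SO3_orbits {inv_f0, inv_aa, inv_trQ2, inv_detQ, inv_aQa, inv_aQ2a, inv_eps}"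
  unfolding separates_SO3_orbits_def
proof (intro ballI impI)
  fix c d
  assume cd: "c \<in> V2" "d \<in> V2"
    and eq: "\<forall>\<phi>\<in>{inv_f0, inv_aa, inv_trQ2, inv_detQ, inv_aQa, inv_aQ2a, inv_eps}. \<phi> c = \<phi> d"
  obtain U f0 \<alpha> l where U: "rotation_matrix U" "act U c = (f0, \<alpha>, diagonal l)" "f0 = inv_f0 c"
    and l: "l$2 \<le> l$1" "l$3 \<le> l$2" "l$1 + l$2 + l$3 = 0"
    using cd(1) by (rule ex_diagonal_representative)
  obtain W g0 \<beta> m where W: "rotation_matrix W" "act W d = (g0, \<beta>, diagonal m)" "g0 = inv_f0 d"
    and m: "m$2 \<le> m$1" "m$3 \<le> m$2" "m$1 + m$2 + m$3 = 0"
    using cd(2) by (rule ex_diagonal_representative)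
  have "g0 = f0"
    using bspec[OF eq, of inv_f0] by (simp add: U(3) W(3))
  have eq': "\<phi> (f0, \<alpha>, diagonal l) = \<phi> (g0, \<beta>, diagonal m)"
    if "\<phi> \<in> {inv_f0, inv_aa, inv_trQ2, inv_detQ, inv_aQa, inv_aQ2a, inv_eps}" for \<phi>
  proof -
    have inv: "\<phi> (act R x) = \<phi> x" if "rotation_matrix R" for R x
      using that \<open>\<phi> \<in> _\<close> by (auto simp: rotation_matrix_def invariants_act)
    show ?thesis
      using bspec[OF eq that] inv[OF U(1), of c] inv[OF W(1), of d]
      by (simp only: U(2) W(2))
  qed
  have e2: "inv_trQ2 (f0, \<alpha>, diagonal l) = inv_trQ2 (g0, \<beta>, diagonal m)"
    and e3: "inv_detQ (f0, \<alpha>, diagonal l) = inv_detQ (g0, \<beta>, diagonal m)"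
    by (rule eq', simp)+
  have "l$1 + l$2 + l$3 = m$1 + m$2 + m$3"
    by (simp only: l m)
  then have "l = m"
    by (rule sorted_triple_eq[OF l(1,2) m(1,2) _ e2[unfolded invariants_diagonal]
          e3[unfolded invariants_diagonal]])
  have "inv_aa (f0, \<alpha>, diagonal l) = inv_aa (g0, \<beta>, diagonal l)"
    "inv_aQa (f0, \<alpha>, diagonal l) = inv_aQa (g0, \<beta>, diagonal l)"
    "inv_aQ2a (f0, \<alpha>, diagonal l) = inv_aQ2a (g0, \<beta>, diagonal l)"
    "inv_eps (f0, \<alpha>, diagonal l) = inv_eps (g0, \<beta>, diagonal l)"
    unfolding \<open>l = m\<close> by (rule eq'[unfolded \<open>l = m\<close>], simp)+
  note inv = this[unfolded invariants_diagonal neg_equal_iff_equal]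
  obtain S where S: "rotation_matrix S" "S *v \<alpha> = \<beta>" "S ** diagonal l ** transpose S = diagonal l"
    by (rule ex_rotation_fixing_diagonal[OF l inv])
  have "act S (act U c) = act W d"
    by (simp add: U(2) W(2) act_def[of S] S \<open>l = m\<close>[symmetric] \<open>g0 = f0\<close>)
  \<comment> \<open>The rotation sought goes from \<open>c\<close> to its diagonal representative by
    \<open>U\<close>, on to that of \<open>d\<close> by \<open>S\<close>, and back to
    \<open>d\<close> by the inverse of \<open>W\<close>.\<close>
  have "act (transpose W ** (S ** U)) c = act (transpose W) (act S (act U c))"
    by (simp only: act_act)
  also have "\<dots> = act (transpose W ** W) d"
    unfolding \<open>act S (act U c) = act W d\<close> by (rule act_act)
  also have "\<dots> = d"
    using W(1) by (simp add: act_id rotation_matrix_def orthogonal_matrix_def)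
  finally have "act (transpose W ** (S ** U)) c = d" .
  then show "\<exists>R. rotation_matrix R \<and> act R c = d"
    using U(1) S(1) W(1) by (blast intro: rotation_matrix_mult rotation_matrix_transpose)
qed

section \<open>Binary forms\<close>

lemma partial_1_bform: "partial 1 (bform (Suc n) a) = bform n (\<lambda>k. of_nat (Suc n) * a k)"
proof
  fix z :: "complex^2"
  have "((\<lambda>t. bform (Suc n) a (z + t *s axis 1 1)) has_field_derivative
      (\<Sum>k\<le>Suc n. of_nat (Suc n choose k) * a k * (of_nat (Suc n - k) * z$1 ^ (n - k)) * z$2 ^ k)) (at 0)"
    unfolding bform_def
    by (rule derivative_eq_intros refl | simp add: axis_def mult.commute)+
  then have "partial 1 (bform (Suc n) a) z =
      (\<Sum>k\<le>Suc n. of_nat ((Suc n - k) * (Suc n choose k)) * a k * z$1 ^ (n - k) * z$2 ^ k)"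
    unfolding partial_def by (simp add: DERIV_imp_deriv mult.assoc mult.left_commute)
  \<comment> \<open>The identity (n+1-k) C(n+1,k) = (n+1) C(n,k) restores the binomial normalisation
    without an index shift; the top term drops out because C(n,n+1) = 0.\<close>
  also have "\<dots> = bform n (\<lambda>k. of_nat (Suc n) * a k) z"
    unfolding binomial_absorb_comp by (simp add: bform_def binomial_eq_0 algebra_simps)
  finally show "partial 1 (bform (Suc n) a) z = bform n (\<lambda>k. of_nat (Suc n) * a k) z" .
qed

lemma partial_2_bform: "partial 2 (bform (Suc n) a) = bform n (\<lambda>k. of_nat (Suc n) * a (Suc k))"
proof
  fix z :: "complex^2"
  have "((\<lambda>t. bform (Suc n) a (z + t *s axis 2 1)) has_field_derivative
      (\<Sum>k\<le>Suc n. of_nat (Suc n choose k) * a k * z$1 ^ (Suc n - k) * (of_nat k * z$2 ^ (k - 1)))) (at 0)"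
    unfolding bform_def
    by (rule derivative_eq_intros refl | simp add: axis_def mult.commute)+
  then have "partial 2 (bform (Suc n) a) z =
      (\<Sum>k\<le>Suc n. of_nat (k * (Suc n choose k)) * a k * z$1 ^ (Suc n - k) * z$2 ^ (k - 1))"
    unfolding partial_def by (simp add: DERIV_imp_deriv mult.assoc mult.left_commute)
  \<comment> \<open>The term k = 0 vanishes. After a shift of the index, k C(n+1,k) = (n+1) C(n,k-1)
    restores the normalisation, and the coefficients move down by one place.\<close>
  also have "\<dots> = bform n (\<lambda>k. of_nat (Suc n) * a (Suc k)) z"
    unfolding sum.atMost_Suc_shift Suc_times_binomial
    by (simp add: bform_def algebra_simps)
  finally show "partial 2 (bform (Suc n) a) z = bform n (\<lambda>k. of_nat (Suc n) * a (Suc k)) z" .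
qed

lemma partial_1_funpow_bform:
  "(partial 1 ^^ i) (bform (m + i) a) = bform m (\<lambda>k. fact (m + i) / fact m * a k)"
  by (induction i arbitrary: a)
    (simp_all add: funpow_Suc_right partial_1_bform algebra_simps del: funpow.simps)

lemma partial_2_funpow_bform:
  "(partial 2 ^^ i) (bform (m + i) a) = bform m (\<lambda>k. fact (m + i) / fact m * a (k + i))"
  by (induction i arbitrary: a)
    (simp_all add: funpow_Suc_right partial_2_bform algebra_simps del: funpow.simps)

text \<open>The full transvectant of two forms of equal degree is the apolar pairing: the
  derivatives exhaust both forms, so the value is constant in \<open>z\<close>, and the two factors
  n! cancel the prefactor.\<close>

lemma transvectant_bform:
  "transvectant n n n (bform n a) (bform n b) z =
     (\<Sum>i\<le>n. (-1) ^ i * of_nat (n choose i) * a i * b (n - i))"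
proof -
  have iter: "(partial 1 ^^ j) ((partial 2 ^^ i) (bform (j + i) c)) z = fact (j + i) * c i" for i j c
    using partial_1_funpow_bform[of j 0] unfolding partial_2_funpow_bform by (simp add: bform_def[of 0])
  have "(partial 1 ^^ (n - i)) ((partial 2 ^^ i) (bform n a)) z = fact n * a i"
    "(partial 1 ^^ i) ((partial 2 ^^ (n - i)) (bform n b)) z = fact n * b (n - i)" if "i \<le> n" for i
    using iter[of "n - i" i a] iter[of i "n - i" b] that by simp_all
  then show ?thesis
    by (simp add: transvectant_def sum_distrib_left mult.assoc)
qed

section \<open>Binary forms as complex vectors and traceless symmetric matrices\<close>

definition coeffs_of_vec :: "complex^3 \<Rightarrow> nat \<Rightarrow> complex" where
  "coeffs_of_vec x k =
     (if k = 0 then x$1 + \<i> * x$2 else if k = 1 then x$3 else - x$1 + \<i> * x$2)"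

text \<open>The inverse of \<open>coeffs_of_vec\<close>. Fractions appear as constant factors so
  that the rules of \<open>joint_polynomial\<close> apply.\<close>

definition vec_of_coeffs :: "(nat \<Rightarrow> complex) \<Rightarrow> complex^3" where
  "vec_of_coeffs a = vector [1/2 * (a 0 - a 2), - \<i>/2 * (a 0 + a 2), a 1]"

text \<open>The normalised coefficients of the quartic of \<open>M\<close> for symmetric traceless
  \<open>M\<close>. The middle one, (4 M33 - 2 M11 - 2 M22)/6, collapses to M33 because the trace
  vanishes.\<close>

definition coeffs_of_mat :: "complex^3^3 \<Rightarrow> nat \<Rightarrow> complex" where
  "coeffs_of_mat M k =
     (if k = 0 then M$1$1 - M$2$2 + 2 * \<i> * M$1$2
      else if k = 1 then M$1$3 + \<i> * M$2$3
      else if k = 2 then M$3$3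
      else if k = 3 then - M$1$3 + \<i> * M$2$3
      else M$1$1 - M$2$2 - 2 * \<i> * M$1$2)"

definition mat_of_coeffs :: "(nat \<Rightarrow> complex) \<Rightarrow> complex^3^3" where
  "mat_of_coeffs b = vector
     [vector [1/4 * (b 0 + b 4) - 1/2 * b 2, - \<i>/4 * (b 0 - b 4), 1/2 * (b 1 - b 3)],
      vector [- \<i>/4 * (b 0 - b 4), - 1/4 * (b 0 + b 4) - 1/2 * b 2, - \<i>/2 * (b 1 + b 3)],
      vector [1/2 * (b 1 - b 3), - \<i>/2 * (b 1 + b 3), b 2]]"

definition complex_traceless_symmetric :: "(complex^3^3) set" where
  "complex_traceless_symmetric = {M. transpose M = M \<and> trace M = 0}"

lemma complex_traceless_symmetric_entries:
  assumes "M \<in> complex_traceless_symmetric"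
  shows "M$2$1 = M$1$2" "M$3$1 = M$1$3" "M$3$2 = M$2$3" "M$3$3 = - M$1$1 - M$2$2"
proof -
  have sym: "M$i$j = M$j$i" for i j
    using assms by (auto simp: complex_traceless_symmetric_def transpose_def vec_eq_iff)
  show "M$2$1 = M$1$2" "M$3$1 = M$1$3" "M$3$2 = M$2$3"
    by (fact sym)+
  have "M$1$1 + M$2$2 + M$3$3 = 0"
    using assms by (simp add: complex_traceless_symmetric_def trace_def sum_3)
  then show "M$3$3 = - M$1$1 - M$2$2"
    by (simp add: add_eq_0_iff)
qed

lemma bform_4: "bform 4 b z = b 0 * z$1^4 + 4 * b 1 * z$1^3 * z$2 + 6 * b 2 * (z$1)\<^sup>2 * (z$2)\<^sup>2
    + 4 * b 3 * z$1 * z$2^3 + b 4 * z$2^4"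
  by (simp add: bform_def atMost_nat_numeral atMost_Suc binomial_eq_0 eval_nat_numeral algebra_simps)

lemma bform_2: "bform 2 a z = a 0 * (z$1)\<^sup>2 + 2 * a 1 * z$1 * z$2 + a 2 * (z$2)\<^sup>2"
  by (simp add: bform_def eval_nat_numeral algebra_simps)

lemma linear_form_null_vector: "linear_form x \<circ> null_vector = bform 2 (coeffs_of_vec x)"
  by (rule ext) (simp add: bform_2 coeffs_of_vec_def linear_form_def null_vector_def sum_3 algebra_simps)

lemma quadratic_form_null_vector:
  assumes "M \<in> complex_traceless_symmetric"
  shows "quadratic_form M \<circ> null_vector = bform 4 (coeffs_of_mat M)"
proof
  fix z :: "complex^2"
  show "(quadratic_form M \<circ> null_vector) z = bform 4 (coeffs_of_mat M) z"
    by (simp add: bform_4 coeffs_of_mat_def quadratic_form_def null_vector_def sum_3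
        complex_traceless_symmetric_entries[OF assms])
       (simp add: algebra_simps power2_eq_square power3_eq_cube power4_eq_xxxx)
qed

lemma vec_of_coeffs_of_vec: "vec_of_coeffs (coeffs_of_vec x) = x"
  by (simp add: vec_of_coeffs_def coeffs_of_vec_def vec_eq_iff forall_3 algebra_simps)

lemma mat_of_coeffs_of_mat:
  assumes "M \<in> complex_traceless_symmetric"
  shows "mat_of_coeffs (coeffs_of_mat M) = M"
  by (simp add: mat_of_coeffs_def coeffs_of_mat_def vec_eq_iff forall_3
      complex_traceless_symmetric_entries[OF assms])
     (simp add: field_simps)

lemma mat_of_coeffs_traceless_symmetric: "mat_of_coeffs b \<in> complex_traceless_symmetric"
  by (simp add: complex_traceless_symmetric_def coord_simps mat_of_coeffs_def)

lemma coeffs_of_vec_of_coeffs: "k \<le> 2 \<Longrightarrow> coeffs_of_vec (vec_of_coeffs a) k = a k"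
  by (auto simp: vec_of_coeffs_def coeffs_of_vec_def le_Suc_eq numeral_2_eq_2 field_simps)

lemma coeffs_of_mat_of_coeffs: "k \<le> 4 \<Longrightarrow> coeffs_of_mat (mat_of_coeffs b) k = b k"
  by (auto simp: mat_of_coeffs_def coeffs_of_mat_def le_Suc_eq eval_nat_numeral field_simps)

lemma bform_cong: "(\<And>k. k \<le> n \<Longrightarrow> a k = b k) \<Longrightarrow> bform n a = bform n b"
  by (auto simp: bform_def intro!: sum.cong)

lemma bform_2_eq_linear_form: "bform 2 a = linear_form (vec_of_coeffs a) \<circ> null_vector"
  unfolding linear_form_null_vector by (rule bform_cong) (simp add: coeffs_of_vec_of_coeffs)

lemma bform_4_eq_quadratic_form: "bform 4 b = quadratic_form (mat_of_coeffs b) \<circ> null_vector"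
  unfolding quadratic_form_null_vector[OF mat_of_coeffs_traceless_symmetric]
  by (rule bform_cong) (simp add: coeffs_of_mat_of_coeffs)

text \<open>The vector \<open>x\<close> for which a binary quadratic equals
  \<open>linear_form x\<close> composed with \<open>null_vector\<close>; \<open>mat_of_form\<close>
  does the same for quartics.\<close>

definition vec_of_form :: "cfun2 \<Rightarrow> complex^3" where
  "vec_of_form A = vec_of_coeffs (bcoeff 2 A)"

definition mat_of_form :: "cfun2 \<Rightarrow> complex^3^3" where
  "mat_of_form F = mat_of_coeffs (bcoeff 4 F)"

lemma vec_of_form_bform: "vec_of_form (bform 2 a) = vec_of_coeffs a"
  by (simp add: vec_of_form_def vec_of_coeffs_def bcoeff_bform)

lemma mat_of_form_bform: "mat_of_form (bform 4 b) = mat_of_coeffs b"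
  by (simp add: mat_of_form_def mat_of_coeffs_def bcoeff_bform)

lemma vec_of_linear_form: "vec_of_form (linear_form x \<circ> null_vector) = x"
  by (simp add: linear_form_null_vector vec_of_form_bform vec_of_coeffs_of_vec)

lemma mat_of_quadratic_form:
  "M \<in> complex_traceless_symmetric \<Longrightarrow> mat_of_form (quadratic_form M \<circ> null_vector) = M"
  by (simp add: quadratic_form_null_vector mat_of_form_bform mat_of_coeffs_of_mat)

lemma binary_form_2_cases:
  assumes "A \<in> binary_forms 2"
  obtains x where "A = linear_form x \<circ> null_vector"
  using assms by (auto simp: binary_forms_def bform_2_eq_linear_form)

lemma binary_form_4_cases:
  assumes "F \<in> binary_forms 4"
  obtains M where "M \<in> complex_traceless_symmetric" "F = quadratic_form M \<circ> null_vector"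
  using assms mat_of_coeffs_traceless_symmetric
  by (auto simp: binary_forms_def bform_4_eq_quadratic_form)

section \<open>The covering of the complex rotation group by SL_2\<close>

text \<open>The matrix of \<open>v(z) \<mapsto> v(gz)\<close>, obtained by substituting
  \<open>z\<^sub>0\<^sup>2 = (v\<^sub>1 - \<i> v\<^sub>2)/2\<close>, \<open>z\<^sub>1\<^sup>2 = - (v\<^sub>1 + \<i> v\<^sub>2)/2\<close> and
  \<open>z\<^sub>0z\<^sub>1 = v\<^sub>3/2\<close>.\<close>

definition spin :: "complex^2^2 \<Rightarrow> complex^3^3" where
  "spin g = (let p = g$1$1; q = g$1$2; r = g$2$1; s = g$2$2 in vector
     [vector [(p\<^sup>2 - q\<^sup>2 - r\<^sup>2 + s\<^sup>2) / 2, - \<i> * (p\<^sup>2 + q\<^sup>2 - r\<^sup>2 - s\<^sup>2) / 2, p * q - r * s],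
      vector [\<i> * (p\<^sup>2 - q\<^sup>2 + r\<^sup>2 - s\<^sup>2) / 2, (p\<^sup>2 + q\<^sup>2 + r\<^sup>2 + s\<^sup>2) / 2, \<i> * (p * q + r * s)],
      vector [p * r - q * s, - \<i> * (p * r + q * s), p * s + q * r]])"

lemma null_vector_mult: "null_vector (g *v z) = spin g *v null_vector z"
  by (simp add: null_vector_def spin_def Let_def vec_eq_iff forall_3 matrix_vector_mult_def sum_2 sum_3)
     (simp add: field_simps power2_eq_square)

text \<open>The bilinear product of v(z) and v(w) is -2 (z0 w1 - z1 w0)^2, and \<open>g\<close>
  multiplies the bracket by det g. Hence \<open>spin g\<close> scales the pairing by (det
  g)^2.\<close>

lemma spin_orthogonal:
  assumes "det g = 1"
  shows "spin g ** transpose (spin g) = mat 1"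
proof -
  define p q r s where "p = g$1$1" "q = g$1$2" "r = g$2$1" "s = g$2$2"
  have d: "p * s - q * r = 1"
    using assms by (simp add: det_2 p_q_r_s_def)
  have "spin g ** transpose (spin g) = (\<chi> i j. if i = j then (p * s - q * r)\<^sup>2 else 0)"
    unfolding spin_def Let_def p_q_r_s_def[symmetric]
    by (simp add: coord_simps) (simp add: field_simps power2_eq_square)
  then show ?thesis
    unfolding d one_power2 by (simp add: mat_def)
qed

text \<open>Orthogonality leaves the sign open; the polynomial identity det (spin g) = (det g)^3
  decides it.\<close>

lemma det_spin:
  assumes "det g = 1"
  shows "det (spin g) = 1"
proof -
  define p q r s where "p = g$1$1" "q = g$1$2" "r = g$2$1" "s = g$2$2"
  have "det (spin g) = (p * s - q * r) ^ 3"
    unfolding spin_def Let_def p_q_r_s_def[symmetric] det_3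
    by (simp add: field_simps power2_eq_square power3_eq_cube)
  then show ?thesis
    using assms by (simp add: det_2 p_q_r_s_def)
qed


lemma SL2_act_null_vector:
  fixes g :: "complex^2^2"
  assumes "det g = 1"
  obtains R :: "complex^3^3" where "transpose R ** R = mat 1" "det R = 1"
    "\<And>x. SL2_act g (linear_form x \<circ> null_vector) = linear_form (R *v x) \<circ> null_vector"
    "\<And>M. SL2_act g (quadratic_form M \<circ> null_vector) =
       quadratic_form (R ** M ** transpose R) \<circ> null_vector"
proof -
  let ?h = "matrix_inv g"
  have "invertible g"
    using assms by (simp add: invertible_det_nz)
  then have "g ** ?h = mat 1"
    unfolding invertible_def matrix_inv_def by (rule someI2_ex) simp
  then have "det g * det ?h = 1"
    by (metis det_mul det_I)
  then have "det ?h = 1"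
    by (simp add: assms)
  \<comment> \<open>The action substitutes the inverse of \<open>g\<close> into the form; moving its
    spin matrix across the bilinear pairing transposes it.\<close>
  let ?R = "transpose (spin ?h)"
  have "transpose ?R ** ?R = mat 1" "det ?R = 1"
    using spin_orthogonal det_spin \<open>det ?h = 1\<close> by simp_all
  moreover have "linear_form x (spin ?h *v y) = linear_form (?R *v x) y" for x y
    by (simp add: linear_form_def matrix_vector_mult_def transpose_def sum_3 algebra_simps
        del: transpose_matrix_vector)
  then have "SL2_act g (linear_form x \<circ> null_vector) = linear_form (?R *v x) \<circ> null_vector" for x
    by (simp add: SL2_act_def fun_eq_iff null_vector_mult del: transpose_matrix_vector)
  moreover have "quadratic_form M (spin ?h *v y) = quadratic_form (?R ** M ** transpose ?R) y" for M y
    by (simp add: quadratic_form_def matrix_vector_mult_def matrix_matrix_mult_def transpose_def sum_3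
        algebra_simps)
  then have "SL2_act g (quadratic_form M \<circ> null_vector) =
      quadratic_form (?R ** M ** transpose ?R) \<circ> null_vector" for M
    by (simp add: SL2_act_def fun_eq_iff null_vector_mult)
  ultimately show thesis
    by (rule that)
qed

lemma complex_traceless_symmetric_conjugate:
  assumes "M \<in> complex_traceless_symmetric" "transpose R ** R = mat 1"
  shows "R ** M ** transpose R \<in> complex_traceless_symmetric"
proof -
  have "trace (R ** M ** transpose R) = trace (transpose R ** (R ** M))"
    by (rule trace_mul_sym)
  also have "\<dots> = trace M"
    by (simp add: matrix_mul_assoc assms(2))
  finally show ?thesis
    using assms(1)
    by (simp add: complex_traceless_symmetric_def matrix_transpose_mul matrix_mul_assoc)
qed

section \<open>Joint invariants from complex orthogonal invariants\<close>

lemma joint_polynomial_diff: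
  assumes "joint_polynomial p" "joint_polynomial q"
  shows "joint_polynomial (\<lambda>a b. p a b - q a b)"
  using joint_polynomial.add[OF assms(1) joint_polynomial.mult[OF joint_polynomial.const[of "-1"] assms(2)]]
  by simp

lemmas joint_polynomial_intros = joint_polynomial.add joint_polynomial.mult joint_polynomial_diff
  joint_polynomial.const joint_polynomial.quadratic_coeff joint_polynomial.quartic_coeff

lemma joint_polynomial_coordinates:
  "joint_polynomial (\<lambda>a b. vec_of_coeffs a $ 1)" "joint_polynomial (\<lambda>a b. vec_of_coeffs a $ 2)"
  "joint_polynomial (\<lambda>a b. vec_of_coeffs a $ 3)"
  "joint_polynomial (\<lambda>a b. mat_of_coeffs b $ 1 $ 1)" "joint_polynomial (\<lambda>a b. mat_of_coeffs b $ 1 $ 2)"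
  "joint_polynomial (\<lambda>a b. mat_of_coeffs b $ 1 $ 3)" "joint_polynomial (\<lambda>a b. mat_of_coeffs b $ 2 $ 1)"
  "joint_polynomial (\<lambda>a b. mat_of_coeffs b $ 2 $ 2)" "joint_polynomial (\<lambda>a b. mat_of_coeffs b $ 2 $ 3)"
  "joint_polynomial (\<lambda>a b. mat_of_coeffs b $ 3 $ 1)" "joint_polynomial (\<lambda>a b. mat_of_coeffs b $ 3 $ 2)"
  "joint_polynomial (\<lambda>a b. mat_of_coeffs b $ 3 $ 3)"
  unfolding vec_of_coeffs_def mat_of_coeffs_def vector_3
  by (intro joint_polynomial_intros; simp)+

text \<open>In the coordinates (x, M), SL_2 acts through complex orthogonal matrices of determinant
  one, so it is enough to verify the properties of \<open>\<phi>\<close> on vectors and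
  matrices.\<close>

lemma joint_invariantI:
  assumes polynomial: "joint_polynomial (\<lambda>a b. \<phi> (vec_of_coeffs a) (mat_of_coeffs b))"
    and invariant: "\<And>R x M. transpose R ** R = mat 1 \<Longrightarrow> det R = 1 \<Longrightarrow>
      \<phi> (R *v x) (R ** M ** transpose R) = \<phi> x M"
    and scale: "\<And>s t x M. \<phi> (s *s x) (\<chi> i j. t * M$i$j) = s ^ p * t ^ q * \<phi> x M"
    and nonzero: "M0 \<in> complex_traceless_symmetric" "\<phi> x0 M0 \<noteq> 0"
  shows "joint_invariant p q (\<lambda>A F. \<phi> (vec_of_form A) (mat_of_form F))"
  unfolding joint_invariant_def
proof (intro conjI allI impI ballI)
  show "\<exists>P. joint_polynomial P \<and> (\<forall>a b. \<phi> (vec_of_form (bform 2 a)) (mat_of_form (bform 4 b)) = P a b)"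
    using polynomial by (auto simp: vec_of_form_bform mat_of_form_bform)
next
  fix g :: "complex^2^2" and A F
  assume g: "det g = 1" and "A \<in> binary_forms 2" "F \<in> binary_forms 4"
  then obtain x M where A: "A = linear_form x \<circ> null_vector"
    and M: "M \<in> complex_traceless_symmetric" and F: "F = quadratic_form M \<circ> null_vector"
    by (metis binary_form_2_cases binary_form_4_cases)
  obtain R :: "complex^3^3" where R: "transpose R ** R = mat 1" "det R = 1"
    "SL2_act g A = linear_form (R *v x) \<circ> null_vector"
    "SL2_act g F = quadratic_form (R ** M ** transpose R) \<circ> null_vector"
    using SL2_act_null_vector[OF g] unfolding A F by metis
  \<comment> \<open>Conjugation keeps \<open>M\<close> symmetric and traceless, so the data
    recovered from the transformed forms are the transformed vector and matrix.\<close>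
  show "\<phi> (vec_of_form (SL2_act g A)) (mat_of_form (SL2_act g F)) =
      \<phi> (vec_of_form A) (mat_of_form F)"
    using invariant[OF R(1,2)] M complex_traceless_symmetric_conjugate[OF M R(1)]
    unfolding R(3,4) unfolding A F by (simp add: vec_of_linear_form mat_of_quadratic_form)
next
  fix s t A F
  assume "A \<in> binary_forms 2" "F \<in> binary_forms 4"
  then obtain x M where A: "A = linear_form x \<circ> null_vector"
    and M: "M \<in> complex_traceless_symmetric" and F: "F = quadratic_form M \<circ> null_vector"
    by (metis binary_form_2_cases binary_form_4_cases)
  have "(\<lambda>z. s * A z) = linear_form (s *s x) \<circ> null_vector"
    by (simp add: A linear_form_def sum_3 fun_eq_iff algebra_simps)
  moreover have "(\<lambda>z. t * F z) = quadratic_form (\<chi> i j. t * M$i$j) \<circ> null_vector"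
    by (simp add: F quadratic_form_def sum_3 fun_eq_iff algebra_simps)
  moreover have "(\<chi> i j. t * M$i$j) \<in> complex_traceless_symmetric"
    using M by (simp add: complex_traceless_symmetric_def trace_def transpose_def vec_eq_iff
        flip: sum_distrib_left)
  ultimately show "\<phi> (vec_of_form (\<lambda>z. s * A z)) (mat_of_form (\<lambda>z. t * F z)) =
      s ^ p * t ^ q * \<phi> (vec_of_form A) (mat_of_form F)"
    using M by (simp add: A F vec_of_linear_form mat_of_quadratic_form scale)
next
  show "\<exists>A\<in>binary_forms 2. \<exists>F\<in>binary_forms 4. \<phi> (vec_of_form A) (mat_of_form F) \<noteq> 0"
    using nonzero
    by (intro bexI[of _ "linear_form x0 \<circ> null_vector"] bexI[of _ "quadratic_form M0 \<circ> null_vector"])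
       (auto simp: vec_of_linear_form mat_of_quadratic_form linear_form_null_vector[of x0]
         quadratic_form_null_vector binary_forms_def vec_of_form_bform vec_of_coeffs_of_vec
         mat_of_form_bform mat_of_coeffs_of_mat)
qed

section \<open>Complexification of the real invariants\<close>

definition complex_vec :: "real^3 \<Rightarrow> complex^3" where
  "complex_vec a = (\<chi> i. complex_of_real (a$i))"

definition complex_mat :: "real^3^3 \<Rightarrow> complex^3^3" where
  "complex_mat Q = (\<chi> i j. complex_of_real (Q$i$j))"

lemma complex_mat_traceless_symmetric:
  "Q \<in> traceless_symmetric \<Longrightarrow> complex_mat Q \<in> complex_traceless_symmetric"
  by (auto simp: traceless_symmetric_def complex_traceless_symmetric_def complex_mat_def
      transpose_def trace_def vec_eq_iff simp flip: of_real_sum)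

lemma binary_quadratic_bform: "binary_quadratic a = bform 2 (coeffs_of_vec (complex_vec a))"
  by (simp add: binary_quadratic_def linear_form_null_vector flip: complex_vec_def)

lemma binary_quartic_bform:
  "Q \<in> traceless_symmetric \<Longrightarrow> binary_quartic Q = bform 4 (coeffs_of_mat (complex_mat Q))"
  by (simp add: binary_quartic_def quadratic_form_null_vector complex_mat_traceless_symmetric
      flip: complex_mat_def)

lemma vec_of_binary_quadratic: "vec_of_form (binary_quadratic a) = complex_vec a"
  by (simp add: binary_quadratic_bform vec_of_form_bform vec_of_coeffs_of_vec)

lemma mat_of_binary_quartic:
  "Q \<in> traceless_symmetric \<Longrightarrow> mat_of_form (binary_quartic Q) = complex_mat Q"
  by (simp add: binary_quartic_bform mat_of_form_bform mat_of_coeffs_of_mat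
      complex_mat_traceless_symmetric)

lemma complex_mat_mult:
  "complex_mat Q *v complex_vec a = complex_vec (Q *v a)"
  "complex_mat Q ** complex_mat P = complex_mat (Q ** P)"
  by (simp_all add: complex_mat_def complex_vec_def vec_eq_iff matrix_vector_mult_def
      matrix_matrix_mult_def)

lemma linear_form_complex_vec:
  "linear_form (complex_vec a) (complex_vec b) = complex_of_real (a \<bullet> b)"
  by (simp add: linear_form_def complex_vec_def inner_vec_def)

lemma det_complex_vec:
  "det (transpose (vector [complex_vec a, complex_vec b, complex_vec c])) =
     complex_of_real (det (transpose (vector [a, b, c])))"
  by (simp add: det_3 transpose_def complex_vec_def)

text \<open>The real formula read over the complex numbers with the bilinear pairing. Without
  conjugation it stays polynomial, and it restricts to the real invariant.\<close>

definition joint_aQ2a :: "complex^3 \<Rightarrow> complex^3^3 \<Rightarrow> complex" where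
  "joint_aQ2a x M = linear_form x ((M ** M) *v x)"

definition joint_eps :: "complex^3 \<Rightarrow> complex^3^3 \<Rightarrow> complex" where
  "joint_eps x M = det (transpose (vector [x, M *v x, (M ** M) *v x]))"

lemma joint_aQ2a_complex:
  "joint_aQ2a (complex_vec a) (complex_mat Q) = complex_of_real (inv_aQ2a (f0, a, Q))"
  by (simp add: joint_aQ2a_def complex_mat_mult linear_form_complex_vec inv_aQ2a_def)

lemma joint_eps_complex:
  "joint_eps (complex_vec a) (complex_mat Q) = complex_of_real (inv_eps (f0, a, Q))"
  unfolding joint_eps_def complex_mat_mult det_complex_vec inv_eps_def by simp

lemma joint_sample:
  obtains a Q where "complex_mat Q \<in> complex_traceless_symmetric"
    "joint_aQ2a (complex_vec a) (complex_mat Q) \<noteq> 0" "joint_eps (complex_vec a) (complex_mat Q) \<noteq> 0"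
proof -
  obtain f0 a Q where c: "sample = (f0, a, Q)" by (cases sample)
  have "Q \<in> traceless_symmetric"
    using sample_V2 by (simp add: c V2_def)
  then show thesis
    using sample_values(5,6)
    by (intro that[of Q a]) (simp_all add: complex_mat_traceless_symmetric c
        joint_aQ2a_complex[of _ _ f0] joint_eps_complex[of _ _ f0])
qed

lemma joint_invariant_aQ2a: "joint_invariant 2 2 (\<lambda>A F. joint_aQ2a (vec_of_form A) (mat_of_form F))"
proof -
  obtain a Q where s: "complex_mat Q \<in> complex_traceless_symmetric"
    "joint_aQ2a (complex_vec a) (complex_mat Q) \<noteq> 0"
    using joint_sample by blast
  show ?thesis
  proof (rule joint_invariantI[where \<phi> = joint_aQ2a, OF _ _ _ s])
    show "joint_polynomial (\<lambda>a b. joint_aQ2a (vec_of_coeffs a) (mat_of_coeffs b))"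
      unfolding joint_aQ2a_def linear_form_def matrix_vector_mult_def matrix_matrix_mult_def sum_3
        vec_lambda_beta
      by (intro joint_polynomial.add joint_polynomial.mult joint_polynomial_coordinates)
    show "joint_aQ2a (R *v x) (R ** M ** transpose R) = joint_aQ2a x M"
      if "transpose R ** R = mat 1" for R x M
      unfolding joint_aQ2a_def conjugate_mult[OF that] linear_form_orthogonal[OF that] ..
    show "joint_aQ2a (s *s x) (\<chi> i j. t * M$i$j) = s ^ 2 * t ^ 2 * joint_aQ2a x M" for s t x M
      by (simp add: joint_aQ2a_def linear_form_def matrix_vector_mult_def matrix_matrix_mult_def sum_3
          power2_eq_square algebra_simps)
  qed
qed

lemma joint_invariant_eps: "joint_invariant 3 3 (\<lambda>A F. joint_eps (vec_of_form A) (mat_of_form F))"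
proof -
  obtain a Q where s: "complex_mat Q \<in> complex_traceless_symmetric"
    "joint_eps (complex_vec a) (complex_mat Q) \<noteq> 0"
    using joint_sample by blast
  show ?thesis
  proof (rule joint_invariantI[where \<phi> = joint_eps, OF _ _ _ s])
    show "joint_polynomial (\<lambda>a b. joint_eps (vec_of_coeffs a) (mat_of_coeffs b))"
      unfolding joint_eps_def det_3 transpose_def matrix_vector_mult_def matrix_matrix_mult_def sum_3
        vec_lambda_beta vector_3
      by (intro joint_polynomial.add joint_polynomial.mult joint_polynomial_diff
          joint_polynomial_coordinates)
    \<comment> \<open>The factor det R produced by the three columns is 1 here.\<close>
    show "joint_eps (R *v x) (R ** M ** transpose R) = joint_eps x M"
      if "transpose R ** R = mat 1" "det R = 1" for R x M
      unfolding joint_eps_def conjugate_mult[OF that(1)] det_columns_mult that(2) by simp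
    show "joint_eps (s *s x) (\<chi> i j. t * M$i$j) = s ^ 3 * t ^ 3 * joint_eps x M" for s t x M
      unfolding joint_eps_def by (rule det_krylov_scale)
  qed
qed

section \<open>Classical invariants of the quadratic and the quartic\<close>

lemma norm_eq_disc: "complex_of_real ((norm a)\<^sup>2) = 1 / 4 * disc (binary_quadratic a)"
  unfolding power2_norm_eq_inner
  by (simp add: disc_def binary_quadratic_bform bcoeff_bform coeffs_of_vec_def complex_vec_def
      inner_vec_def sum_3 power2_eq_square algebra_simps)

text \<open>The constant can be read off at Q = diag(1,-1,0): the quartic has end coefficients 2 and
  zeros between, so I = 4, while tr(Q^2) = 2.\<close>

lemma trace_eq_quartic_I:
  assumes "Q \<in> traceless_symmetric"
  shows "complex_of_real (trace (Q ** Q)) = 1 / 2 * quartic_I (binary_quartic Q)"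
  by (simp add: quartic_I_def Let_def binary_quartic_bform[OF assms] bcoeff_bform coeffs_of_mat_def
      complex_mat_def trace_def matrix_matrix_mult_def sum_3 traceless_symmetric_entries[OF assms])
     (simp add: power2_eq_square field_simps)

text \<open>The constant can be read off at Q = diag(1,1,-2): only the middle coefficient -2
  survives, so J = 8, while det Q = -2.\<close>

lemma det_eq_quartic_J:
  assumes "Q \<in> traceless_symmetric"
  shows "complex_of_real (det Q) = - 1 / 4 * quartic_J (binary_quartic Q)"
  by (simp add: quartic_J_def Let_def binary_quartic_bform[OF assms] bcoeff_bform coeffs_of_mat_def
      complex_mat_def det_3 traceless_symmetric_entries[OF assms])
     (simp add: field_simps)

lemma inner_eq_transvectant:
  assumes "Q \<in> traceless_symmetric"
  shows "complex_of_real (a \<bullet> (Q *v a)) =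
    1 / 4 * transvectant 4 4 4 (\<lambda>w. (binary_quadratic a w)\<^sup>2) (binary_quartic Q) z"
proof -
  define c where "c = coeffs_of_vec (complex_vec a)"
  \<comment> \<open>The coefficients of the squared quadratic with the binomials 1, 4, 6, 4, 1
    divided out; the middle one is (4 c1^2 + 2 c0 c2)/6.\<close>
  define d where "d = (\<lambda>k::nat. if k = 0 then c 0 * c 0 else if k = 1 then c 0 * c 1
    else if k = 2 then (2 * (c 1 * c 1) + c 0 * c 2) / 3 else if k = 3 then c 1 * c 2 else c 2 * c 2)"
  have "(\<lambda>w. (binary_quadratic a w)\<^sup>2) = bform 4 d"
    by (rule ext) (simp add: binary_quadratic_bform bform_2 bform_4 d_def flip: c_def,
        simp add: field_simps power2_eq_square power3_eq_cube power4_eq_xxxx)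
  then have "transvectant 4 4 4 (\<lambda>w. (binary_quadratic a w)\<^sup>2) (binary_quartic Q) z =
      (\<Sum>i\<le>4. (-1) ^ i * of_nat (4 choose i) * d i * coeffs_of_mat (complex_mat Q) (4 - i))"
    by (simp add: binary_quartic_bform[OF assms] transvectant_bform)
  also have "\<dots> = 4 * complex_of_real (a \<bullet> (Q *v a))"
    by (simp add: atMost_nat_numeral atMost_Suc eval_nat_numeral d_def c_def coeffs_of_vec_def coeffs_of_mat_def
        complex_mat_def complex_vec_def inner_vec_def matrix_vector_mult_def sum_3
        traceless_symmetric_entries[OF assms])
       (simp add: field_simps)
  finally show ?thesis by simp
qed

theorem theorem4p9:
  shows
    "bij_betw to_harmonics V2 harmonic_sum
     \<and> (\<forall>R. orthogonal_matrix R \<longrightarrow> (\<forall>c\<in>V2. act R c \<in> V2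
          \<and> to_harmonics (act R c) = rotate_harmonics R (to_harmonics c)))
     \<and> polynomial_of_degree 1 inv_f0 \<and> polynomial_of_degree 2 inv_aa
     \<and> polynomial_of_degree 2 inv_trQ2 \<and> polynomial_of_degree 3 inv_detQ
     \<and> polynomial_of_degree 3 inv_aQa \<and> polynomial_of_degree 4 inv_aQ2a
     \<and> polynomial_of_degree 6 inv_eps
     \<and> separates_SO3_orbits {inv_f0, inv_aa, inv_trQ2, inv_detQ, inv_aQa, inv_aQ2a, inv_eps}
     \<and> (\<forall>\<phi>\<in>{inv_f0, inv_aa, inv_trQ2, inv_detQ, inv_aQa, inv_aQ2a}. O3_invariant \<phi>)
     \<and> pseudo_invariant inv_eps
     \<and> (\<forall>f0 a Q. (f0, a, Q) \<in> V2 \<longrightarrow>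
          (inv_eps (f0, a, Q))\<^sup>2 = det (Gram (vector [a, Q *v a, (Q ** Q) *v a])))
     \<and> (\<forall>Q\<in>traceless_symmetric.
          Q ** Q ** Q = (trace (Q ** Q) / 2) *\<^sub>R Q + det Q *\<^sub>R mat 1)
     \<and> (\<exists>P :: real \<times> real \<times> real \<times> real \<times> real \<times> real \<Rightarrow> real. real_polynomial_function P \<and>
          (\<forall>f0 a Q. (f0, a, Q) \<in> V2 \<longrightarrow>
             det (Gram (vector [a, Q *v a, (Q ** Q) *v a])) =
             P (inv_f0 (f0, a, Q), inv_aa (f0, a, Q), inv_trQ2 (f0, a, Q),
                inv_detQ (f0, a, Q), inv_aQa (f0, a, Q), inv_aQ2a (f0, a, Q))))
     \<and> (\<forall>a :: real^3. complex_of_real ((norm a)\<^sup>2) = 1 / 4 * disc (binary_quadratic a))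
     \<and> (\<exists>\<kappa>. \<kappa> \<noteq> 0 \<and> (\<forall>Q\<in>traceless_symmetric.
          complex_of_real (trace (Q ** Q)) = \<kappa> * quartic_I (binary_quartic Q)))
     \<and> (\<exists>\<kappa>. \<kappa> \<noteq> 0 \<and> (\<forall>Q\<in>traceless_symmetric.
          complex_of_real (det Q) = \<kappa> * quartic_J (binary_quartic Q)))
     \<and> (\<exists>\<kappa>. \<kappa> \<noteq> 0 \<and> (\<forall>a. \<forall>Q\<in>traceless_symmetric. \<forall>z.
          complex_of_real (a \<bullet> (Q *v a)) =
          \<kappa> * transvectant 4 4 4 (\<lambda>w. (binary_quadratic a w)\<^sup>2) (binary_quartic Q) z))
     \<and> (\<exists>\<Phi>. joint_invariant 2 2 \<Phi> \<and> (\<forall>f0 a Q. (f0, a, Q) \<in> V2 \<longrightarrow>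
          complex_of_real (inv_aQ2a (f0, a, Q)) = \<Phi> (binary_quadratic a) (binary_quartic Q)))
     \<and> (\<exists>\<Phi>. joint_invariant 3 3 \<Phi> \<and> (\<forall>f0 a Q. (f0, a, Q) \<in> V2 \<longrightarrow>
          complex_of_real (inv_eps (f0, a, Q)) = \<Phi> (binary_quadratic a) (binary_quartic Q)))"
proof (intro conjI)
  show "bij_betw to_harmonics V2 harmonic_sum"
    by (rule bij_betw_to_harmonics)
  show "\<forall>R. orthogonal_matrix R \<longrightarrow> (\<forall>c\<in>V2. act R c \<in> V2
      \<and> to_harmonics (act R c) = rotate_harmonics R (to_harmonics c))"
    by (simp add: act_V2 to_harmonics_act)
  show "polynomial_of_degree 1 inv_f0" "polynomial_of_degree 2 inv_aa" "polynomial_of_degree 2 inv_trQ2"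
    "polynomial_of_degree 3 inv_detQ" "polynomial_of_degree 3 inv_aQa"
    "polynomial_of_degree 4 inv_aQ2a" "polynomial_of_degree 6 inv_eps"
    by (fact polynomial_of_degree_invariants)+
  show "separates_SO3_orbits {inv_f0, inv_aa, inv_trQ2, inv_detQ, inv_aQa, inv_aQ2a, inv_eps}"
    by (rule separates_SO3_orbits_invariants)
  show "\<forall>\<phi>\<in>{inv_f0, inv_aa, inv_trQ2, inv_detQ, inv_aQa, inv_aQ2a}. O3_invariant \<phi>"
    by (intro ballI O3_invariant_invariants)
  show "pseudo_invariant inv_eps"
    by (rule pseudo_invariant_eps)
  show "\<forall>f0 a Q. (f0, a, Q) \<in> V2 \<longrightarrow>
      (inv_eps (f0, a, Q))\<^sup>2 = det (Gram (vector [a, Q *v a, (Q ** Q) *v a]))"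
    by (intro allI impI inv_eps_squared)
  show "\<forall>Q\<in>traceless_symmetric.
      Q ** Q ** Q = (trace (Q ** Q) / 2) *\<^sub>R Q + det Q *\<^sub>R mat 1"
    by (intro ballI cayley_hamilton_traceless_symmetric)
  show "\<exists>P :: real \<times> real \<times> real \<times> real \<times> real \<times> real \<Rightarrow> real. real_polynomial_function P \<and>
      (\<forall>f0 a Q. (f0, a, Q) \<in> V2 \<longrightarrow>
         det (Gram (vector [a, Q *v a, (Q ** Q) *v a])) =
         P (inv_f0 (f0, a, Q), inv_aa (f0, a, Q), inv_trQ2 (f0, a, Q),
            inv_detQ (f0, a, Q), inv_aQa (f0, a, Q), inv_aQ2a (f0, a, Q)))"
    by (rule ex_gram_polynomial)
  show "\<forall>a :: real^3. complex_of_real ((norm a)\<^sup>2) = 1 / 4 * disc (binary_quadratic a)"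
    by (intro allI norm_eq_disc)
  show "\<exists>\<kappa>. \<kappa> \<noteq> 0 \<and> (\<forall>Q\<in>traceless_symmetric.
      complex_of_real (trace (Q ** Q)) = \<kappa> * quartic_I (binary_quartic Q))"
    by (intro exI[of _ "1 / 2"] conjI ballI trace_eq_quartic_I) simp
  show "\<exists>\<kappa>. \<kappa> \<noteq> 0 \<and> (\<forall>Q\<in>traceless_symmetric.
      complex_of_real (det Q) = \<kappa> * quartic_J (binary_quartic Q))"
    by (intro exI[of _ "- 1 / 4"] conjI ballI det_eq_quartic_J) simp
  show "\<exists>\<kappa>. \<kappa> \<noteq> 0 \<and> (\<forall>a. \<forall>Q\<in>traceless_symmetric. \<forall>z.
      complex_of_real (a \<bullet> (Q *v a)) =
      \<kappa> * transvectant 4 4 4 (\<lambda>w. (binary_quadratic a w)\<^sup>2) (binary_quartic Q) z)"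
    by (intro exI[of _ "1 / 4"] conjI ballI allI inner_eq_transvectant) simp
  show "\<exists>\<Phi>. joint_invariant 2 2 \<Phi> \<and> (\<forall>f0 a Q. (f0, a, Q) \<in> V2 \<longrightarrow>
      complex_of_real (inv_aQ2a (f0, a, Q)) = \<Phi> (binary_quadratic a) (binary_quartic Q))"
    by (intro exI[of _ "\<lambda>A F. joint_aQ2a (vec_of_form A) (mat_of_form F)"] conjI joint_invariant_aQ2a)
       (simp add: V2_def vec_of_binary_quadratic mat_of_binary_quartic
          flip: joint_aQ2a_complex)
  show "\<exists>\<Phi>. joint_invariant 3 3 \<Phi> \<and> (\<forall>f0 a Q. (f0, a, Q) \<in> V2 \<longrightarrow>
      complex_of_real (inv_eps (f0, a, Q)) = \<Phi> (binary_quadratic a) (binary_quartic Q))"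
    by (intro exI[of _ "\<lambda>A F. joint_eps (vec_of_form A) (mat_of_form F)"] conjI joint_invariant_eps)
       (simp add: V2_def vec_of_binary_quadratic mat_of_binary_quartic
          flip: joint_eps_complex)
qed

end
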